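(* Let $(M,\lambda_i(x,y),F(x,y))$ be an FP-space. The $(h)h$-, $(h)hv$-, $(v)hv$- and $(v)v$-torsion tensors of the canonical connection $D=(\Gamma^\alpha_{\mu\nu},N^\alpha_\mu,C^\alpha_{\mu\nu})$ are given respectively by: (a) $T^\alpha_{\mu\nu}=\Gamma^\alpha_{\mu\nu}-\Gamma^\alpha_{\nu\mu}$; (b) $C^\alpha_{\mu\nu}=\lambda_i^\alpha\,(\dot\partial_\nu\lambda_{i\mu})$; (c) $P^\alpha_{\mu\nu}=y^\beta\big[C^\alpha_{\mu\nu|\beta}-B^\alpha_{\mu\nu|\beta}-A^\alpha_{\eta\beta}(C^\eta_{\mu\nu}-B^\eta_{\mu\nu})+A^\eta_{\mu\beta}(C^\alpha_{\eta\nu}-B^\alpha_{\eta\nu})+A^\eta_{\nu\beta}(C^\alpha_{\mu\eta}-B^\alpha_{\mu\eta})\big]-A^\alpha_{\mu\nu}$; (d) $S^\alpha_{\mu\nu}=C^\alpha_{\mu\nu}-C^\alpha_{\nu\mu}$.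
   Context: $M$ is a smooth $n$-dimensional manifold, $\pi:TM\to M$, $\tau M:=TM\setminus\{0\}$, $(x^\mu,y^\mu)$ the induced coordinates on $TM$, $\partial_\mu:=\partial/\partial x^\mu$, $\dot\partial_\mu:=\partial/\partial y^\mu$. Repeated indices (Greek, and the Latin index $i=1,\dots,n$) are summed. All objects live on $\tau M$. The pullback bundle $\pi^{-1}(TM)$ has fibre $T_xM$ over $(x,y)$; its sections have components $X^\alpha(x,y)$ transforming like vectors on $M$. FP-space $(M,\lambda_i,F)$: $M$ together with $n$ global sections $\lambda_i$ of $\pi^{-1}(TM)$, smooth over $\tau M$ and linearly independent at each point, with components $\lambda_i^\alpha$ and inverse matrix $(\lambda_{i\alpha})$, such that, with $g_{\mu\nu}:=\lambda_{i\mu}\lambda_{i\nu}$: (1) $\dot\partial_\alpha g_{\mu\nu}$ is totally symmetric; (2) each $\lambda_i$ is positively homogeneous of degree zero in $y$; and $F:=\sqrt{g_{\mu\nu}y^\mu y^\nu}$. $g^{\mu\nu}$ is the inverse of $g_{\mu\nu}$. $\gamma^\alpha_{\mu\nu}:=\frac12g^{\alpha\eta}(\partial_\mu g_{\nu\eta}+\partial_\nu g_{\mu\eta}-\partial_\eta g_{\mu\nu})$; $G^\alpha:=\frac12\gamma^\alpha_{\mu\nu}y^\mu y^\nu$; $N^\alpha_\beta:=\dot\partial_\beta G^\alpha$ (Barthel connection); $\delta_\mu:=\partial_\mu-N^\alpha_\mu\dot\partial_\alpha$. $\overset{\circ}{\Gamma}{}^\alpha_{\mu\nu}:=\frac12g^{\alpha\eta}(\delta_\mu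 g_{\nu\eta}+\delta_\nu g_{\mu\eta}-\delta_\eta g_{\mu\nu})$, $\overset{\circ}{C}{}^\alpha_{\mu\nu}:=\frac12g^{\alpha\eta}(\dot\partial_\mu g_{\nu\eta}+\dot\partial_\nu g_{\mu\eta}-\dot\partial_\eta g_{\mu\nu})$. Canonical connection: $\Gamma^\alpha_{\mu\nu}=\lambda_i^\alpha\,\delta_\nu\lambda_{i\mu}$, $N^\alpha_\mu$, $C^\alpha_{\mu\nu}=\lambda_i^\alpha\,\dot\partial_\nu\lambda_{i\mu}$. Contortion tensors: $A^\alpha_{\mu\nu}=\Gamma^\alpha_{\mu\nu}-\overset{\circ}{\Gamma}{}^\alpha_{\mu\nu}$, $B^\alpha_{\mu\nu}=C^\alpha_{\mu\nu}-\overset{\circ}{C}{}^\alpha_{\mu\nu}$. The $h$-covariant derivative with respect to the canonical connection is $X^\alpha_{\mu\nu|\beta}=\delta_\beta X^\alpha_{\mu\nu}+X^\eta_{\mu\nu}\Gamma^\alpha_{\eta\beta}-X^\alpha_{\eta\nu}\Gamma^\eta_{\mu\beta}-X^\alpha_{\mu\eta}\Gamma^\eta_{\nu\beta}$. For a Finsler connection $(\mathbf F,\mathbf N,\mathbf C)$: the $(h)h$-torsion is $\mathbf F^\alpha_{\mu\nu}-\mathbf F^\alpha_{\nu\mu}$; the $(h)hv$-torsion is $\mathbf C^\alpha_{\mu\nu}$; the $(v)hv$-torsion is $\dot\partial_\nu\mathbf N^\alpha_\mu-\mathbf F^\alpha_{\mu\nu}$; the $(v)v$-torsion is $\mathbf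 C^\alpha_{\mu\nu}-\mathbf C^\alpha_{\nu\mu}$. *)

theory Defs
  imports "HOL-Analysis.Analysis"
begin

section \<open>Smooth maps and smooth manifolds\<close>

text \<open>Used for open \<^term>\<open>S\<close> only: at each point the Frechet derivative \<open>at x\<close> is the full
  (not the one-sided) derivative.\<close>

primrec times_differentiable_on ::
  "nat \<Rightarrow> ('a::real_normed_vector \<Rightarrow> 'b::real_normed_vector) \<Rightarrow> 'a set \<Rightarrow> bool" where
  "times_differentiable_on 0 f S \<longleftrightarrow> continuous_on S f"
| "times_differentiable_on (Suc k) f S \<longleftrightarrow>
     (\<forall>x\<in>S. f differentiable (at x)) \<and>
     (\<forall>v. times_differentiable_on k (\<lambda>x. frechet_derivative f (at x) v) S)"

definition smooth_on :: "('a::real_normed_vector \<Rightarrow> 'b::real_normed_vector) \<Rightarrow> 'a set \<Rightarrow> bool" where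
  "smooth_on f S \<longleftrightarrow> (\<forall>k. times_differentiable_on k f S)"

text \<open>A chart is a pair of its domain and its coordinate map; the dimension is \<open>CARD('n)\<close>.\<close>

type_synonym ('a, 'n) chart = "'a set \<times> ('a \<Rightarrow> real ^ 'n)"

definition is_chart :: "'a topology \<Rightarrow> ('a, 'n::finite) chart \<Rightarrow> bool" where
  "is_chart M c \<longleftrightarrow> openin M (fst c) \<and> open (snd c ` fst c) \<and>
     homeomorphic_map (subtopology M (fst c)) (top_of_set (snd c ` fst c)) (snd c)"

definition chart_inv :: "('a, 'n::finite) chart \<Rightarrow> real ^ 'n \<Rightarrow> 'a" where
  "chart_inv c = inv_into (fst c) (snd c)"

definition transition :: "('a, 'n::finite) chart \<Rightarrow> ('a, 'n) chart \<Rightarrow> real ^ 'n \<Rightarrow> real ^ 'n" where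
  "transition c d = snd d \<circ> chart_inv c"

definition smooth_manifold :: "'a topology \<Rightarrow> ('a, 'n::finite) chart set \<Rightarrow> bool" where
  "smooth_manifold M \<A> \<longleftrightarrow>
     Hausdorff_space M \<and> second_countable M \<and>
     (\<forall>c\<in>\<A>. is_chart M c) \<and> (\<Union>c\<in>\<A>. fst c) = topspace M \<and>
     (\<forall>c\<in>\<A>. \<forall>d\<in>\<A>. smooth_on (transition c d) (snd c ` (fst c \<inter> fst d)))"

section \<open>Tangent vectors and sections of the pullback bundle\<close>

text \<open>A tangent vector at \<open>p\<close> is the family of its component vectors in all the charts around \<open>p\<close>,
  related by the Jacobians of the transition maps. Outside these charts the value is \<open>0\<close>, so that
  a tangent vector is determined by its components.\<close>

type_synonym ('a, 'n) tvec = "('a, 'n) chart \<Rightarrow> real ^ 'n"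

definition tangent_space ::
  "('a, 'n::finite) chart set \<Rightarrow> 'a \<Rightarrow> ('a, 'n) tvec set" where
  "tangent_space \<A> p = {v.
     (\<forall>c\<in>\<A>. \<forall>d\<in>\<A>. p \<in> fst c \<and> p \<in> fst d \<longrightarrow>
        v d = frechet_derivative (transition c d) (at (snd c p)) (v c)) \<and>
     (\<forall>c. \<not> (c \<in> \<A> \<and> p \<in> fst c) \<longrightarrow> v c = 0)}"

definition zero_tvec :: "('a, 'n::finite) tvec" where
  "zero_tvec = (\<lambda>c. 0)"

text \<open>The tangent vector at \<open>p\<close> with components \<open>y\<close> in the chart \<open>c\<close>.\<close>

definition tvec_of ::
  "('a, 'n::finite) chart set \<Rightarrow> ('a, 'n) chart \<Rightarrow> 'a \<Rightarrow> real ^ 'n \<Rightarrow> ('a, 'n) tvec" where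
  "tvec_of \<A> c p y = (\<lambda>d. if d \<in> \<A> \<and> p \<in> fst d
     then frechet_derivative (transition c d) (at (snd c p)) y else 0)"

text \<open>The induced coordinates \<open>(x, y)\<close> identify the part of the slit tangent bundle over the domain
  of \<open>c\<close> with the following open set.\<close>

definition slit_domain :: "('a, 'n::finite) chart \<Rightarrow> ((real ^ 'n) \<times> (real ^ 'n)) set" where
  "slit_domain c = (snd c ` fst c) \<times> (- {0})"

text \<open>A section of the pullback bundle maps a point \<open>p\<close> and a nonzero tangent vector \<open>v\<close> at \<open>p\<close> to a
  tangent vector at \<open>p\<close>; \<open>components \<A> c X (x, y)\<close> is the vector of its components \<open>X\<^sup>\<alpha>(x, y)\<close>.\<close>

type_synonym ('a, 'n) psection = "'a \<Rightarrow> ('a, 'n) tvec \<Rightarrow> ('a, 'n) tvec"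

definition components ::
  "('a, 'n::finite) chart set \<Rightarrow> ('a, 'n) chart \<Rightarrow> ('a, 'n) psection
     \<Rightarrow> (real ^ 'n) \<times> (real ^ 'n) \<Rightarrow> real ^ 'n" where
  "components \<A> c X z =
     X (chart_inv c (fst z)) (tvec_of \<A> c (chart_inv c (fst z)) (snd z)) c"

definition smooth_section ::
  "'a topology \<Rightarrow> ('a, 'n::finite) chart set \<Rightarrow> ('a, 'n) psection \<Rightarrow> bool" where
  "smooth_section M \<A> X \<longleftrightarrow>
     (\<forall>p\<in>topspace M. \<forall>v \<in> tangent_space \<A> p - {zero_tvec}. X p v \<in> tangent_space \<A> p) \<and>
     (\<forall>c\<in>\<A>. smooth_on (components \<A> c X) (slit_domain c))"

section \<open>Coordinate expressions\<close>

text \<open>From here on \<open>l i\<close> is the coordinate expression of the \<open>i\<close>-th frame section in some chart and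
  \<open>z = (x, y)\<close>. Index arguments follow the order: upper index, lower indices from left to right.\<close>

type_synonym 'n coord = "(real ^ 'n) \<times> (real ^ 'n)"
type_synonym 'n frame = "'n \<Rightarrow> 'n coord \<Rightarrow> real ^ 'n"

definition dx :: "'n::finite \<Rightarrow> ('n coord \<Rightarrow> real) \<Rightarrow> 'n coord \<Rightarrow> real" where
  "dx \<mu> f z = frechet_derivative f (at z) (axis \<mu> 1, 0)"

definition dy :: "'n::finite \<Rightarrow> ('n coord \<Rightarrow> real) \<Rightarrow> 'n coord \<Rightarrow> real" where
  "dy \<mu> f z = frechet_derivative f (at z) (0, axis \<mu> 1)"

definition frame_up :: "'n::finite frame \<Rightarrow> 'n \<Rightarrow> 'n \<Rightarrow> 'n coord \<Rightarrow> real" where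
  "frame_up l i \<alpha> z = l i z $ \<alpha>"

text \<open>The matrix \<open>\<lambda>\<^sub>i\<^sup>\<alpha>\<close> has row index \<open>i\<close>; its inverse \<open>\<lambda>\<^sub>i\<^sub>\<alpha>\<close> has row index \<open>\<alpha>\<close>.\<close>

definition frame_low :: "'n::finite frame \<Rightarrow> 'n \<Rightarrow> 'n \<Rightarrow> 'n coord \<Rightarrow> real" where
  "frame_low l i \<alpha> z = matrix_inv (\<chi> j \<beta>. frame_up l j \<beta> z) $ \<alpha> $ i"

definition metric :: "'n::finite frame \<Rightarrow> 'n \<Rightarrow> 'n \<Rightarrow> 'n coord \<Rightarrow> real" where
  "metric l \<mu> \<nu> z = (\<Sum>i\<in>UNIV. frame_low l i \<mu> z * frame_low l i \<nu> z)"

definition metric_inv :: "'n::finite frame \<Rightarrow> 'n \<Rightarrow> 'n \<Rightarrow> 'n coord \<Rightarrow> real" where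
  "metric_inv l \<mu> \<nu> z = matrix_inv (\<chi> \<alpha> \<beta>. metric l \<alpha> \<beta> z) $ \<mu> $ \<nu>"

definition christoffel :: "'n::finite frame \<Rightarrow> 'n \<Rightarrow> 'n \<Rightarrow> 'n \<Rightarrow> 'n coord \<Rightarrow> real" where
  "christoffel l \<alpha> \<mu> \<nu> z = 1 / 2 * (\<Sum>\<eta>\<in>UNIV. metric_inv l \<alpha> \<eta> z *
     (dx \<mu> (metric l \<nu> \<eta>) z + dx \<nu> (metric l \<mu> \<eta>) z - dx \<eta> (metric l \<mu> \<nu>) z))"

definition spray :: "'n::finite frame \<Rightarrow> 'n \<Rightarrow> 'n coord \<Rightarrow> real" where
  "spray l \<alpha> z = 1 / 2 * (\<Sum>\<mu>\<in>UNIV. \<Sum>\<nu>\<in>UNIV. christoffel l \<alpha> \<mu> \<nu> z * snd z $ \<mu> * snd z $ \<nu>)"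

definition barthel :: "'n::finite frame \<Rightarrow> 'n \<Rightarrow> 'n \<Rightarrow> 'n coord \<Rightarrow> real" where
  "barthel l \<alpha> \<beta> z = dy \<beta> (spray l \<alpha>) z"

definition delta :: "'n::finite frame \<Rightarrow> 'n \<Rightarrow> ('n coord \<Rightarrow> real) \<Rightarrow> 'n coord \<Rightarrow> real" where
  "delta l \<mu> f z = dx \<mu> f z - (\<Sum>\<alpha>\<in>UNIV. barthel l \<alpha> \<mu> z * dy \<alpha> f z)"

definition Gamma_circ :: "'n::finite frame \<Rightarrow> 'n \<Rightarrow> 'n \<Rightarrow> 'n \<Rightarrow> 'n coord \<Rightarrow> real" where
  "Gamma_circ l \<alpha> \<mu> \<nu> z = 1 / 2 * (\<Sum>\<eta>\<in>UNIV. metric_inv l \<alpha> \<eta> z *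
     (delta l \<mu> (metric l \<nu> \<eta>) z + delta l \<nu> (metric l \<mu> \<eta>) z - delta l \<eta> (metric l \<mu> \<nu>) z))"

definition C_circ :: "'n::finite frame \<Rightarrow> 'n \<Rightarrow> 'n \<Rightarrow> 'n \<Rightarrow> 'n coord \<Rightarrow> real" where
  "C_circ l \<alpha> \<mu> \<nu> z = 1 / 2 * (\<Sum>\<eta>\<in>UNIV. metric_inv l \<alpha> \<eta> z *
     (dy \<mu> (metric l \<nu> \<eta>) z + dy \<nu> (metric l \<mu> \<eta>) z - dy \<eta> (metric l \<mu> \<nu>) z))"

definition Gamma_can :: "'n::finite frame \<Rightarrow> 'n \<Rightarrow> 'n \<Rightarrow> 'n \<Rightarrow> 'n coord \<Rightarrow> real" where
  "Gamma_can l \<alpha> \<mu> \<nu> z = (\<Sum>i\<in>UNIV. frame_up l i \<alpha> z * delta l \<nu> (frame_low l i \<mu>) z)"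

definition C_can :: "'n::finite frame \<Rightarrow> 'n \<Rightarrow> 'n \<Rightarrow> 'n \<Rightarrow> 'n coord \<Rightarrow> real" where
  "C_can l \<alpha> \<mu> \<nu> z = (\<Sum>i\<in>UNIV. frame_up l i \<alpha> z * dy \<nu> (frame_low l i \<mu>) z)"

definition A_cont :: "'n::finite frame \<Rightarrow> 'n \<Rightarrow> 'n \<Rightarrow> 'n \<Rightarrow> 'n coord \<Rightarrow> real" where
  "A_cont l \<alpha> \<mu> \<nu> z = Gamma_can l \<alpha> \<mu> \<nu> z - Gamma_circ l \<alpha> \<mu> \<nu> z"

definition B_cont :: "'n::finite frame \<Rightarrow> 'n \<Rightarrow> 'n \<Rightarrow> 'n \<Rightarrow> 'n coord \<Rightarrow> real" where
  "B_cont l \<alpha> \<mu> \<nu> z = C_can l \<alpha> \<mu> \<nu> z - C_circ l \<alpha> \<mu> \<nu> z"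

text \<open>\<open>hcov l X \<alpha> \<mu> \<nu> \<beta>\<close> is \<open>X\<^sup>\<alpha>\<^sub>\<mu>\<^sub>\<nu>\<^sub>|\<^sub>\<beta>\<close> with respect to the canonical connection.\<close>

definition hcov ::
  "'n::finite frame \<Rightarrow> ('n \<Rightarrow> 'n \<Rightarrow> 'n \<Rightarrow> 'n coord \<Rightarrow> real) \<Rightarrow>
     'n \<Rightarrow> 'n \<Rightarrow> 'n \<Rightarrow> 'n \<Rightarrow> 'n coord \<Rightarrow> real" where
  "hcov l X \<alpha> \<mu> \<nu> \<beta> z = delta l \<beta> (X \<alpha> \<mu> \<nu>) z
     + (\<Sum>\<eta>\<in>UNIV. X \<eta> \<mu> \<nu> z * Gamma_can l \<alpha> \<eta> \<beta> z)
     - (\<Sum>\<eta>\<in>UNIV. X \<alpha> \<eta> \<nu> z * Gamma_can l \<eta> \<mu> \<beta> z)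
     - (\<Sum>\<eta>\<in>UNIV. X \<alpha> \<mu> \<eta> z * Gamma_can l \<eta> \<nu> \<beta> z)"

section \<open>Finsler connections and their torsions\<close>

datatype 'n finsler_connection = Finsler_Connection
  (h_coeff: "'n::finite \<Rightarrow> 'n \<Rightarrow> 'n \<Rightarrow> 'n coord \<Rightarrow> real")
  (n_coeff: "'n \<Rightarrow> 'n \<Rightarrow> 'n coord \<Rightarrow> real")
  (v_coeff: "'n \<Rightarrow> 'n \<Rightarrow> 'n \<Rightarrow> 'n coord \<Rightarrow> real")

definition hh_torsion ::
  "'n::finite finsler_connection \<Rightarrow> 'n \<Rightarrow> 'n \<Rightarrow> 'n \<Rightarrow> 'n coord \<Rightarrow> real" where
  "hh_torsion D \<alpha> \<mu> \<nu> z = h_coeff D \<alpha> \<mu> \<nu> z - h_coeff D \<alpha> \<nu> \<mu> z"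

definition h_hv_torsion ::
  "'n::finite finsler_connection \<Rightarrow> 'n \<Rightarrow> 'n \<Rightarrow> 'n \<Rightarrow> 'n coord \<Rightarrow> real" where
  "h_hv_torsion D \<alpha> \<mu> \<nu> z = v_coeff D \<alpha> \<mu> \<nu> z"

definition v_hv_torsion ::
  "'n::finite finsler_connection \<Rightarrow> 'n \<Rightarrow> 'n \<Rightarrow> 'n \<Rightarrow> 'n coord \<Rightarrow> real" where
  "v_hv_torsion D \<alpha> \<mu> \<nu> z = dy \<nu> (n_coeff D \<alpha> \<mu>) z - h_coeff D \<alpha> \<mu> \<nu> z"

definition vv_torsion ::
  "'n::finite finsler_connection \<Rightarrow> 'n \<Rightarrow> 'n \<Rightarrow> 'n \<Rightarrow> 'n coord \<Rightarrow> real" where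
  "vv_torsion D \<alpha> \<mu> \<nu> z = v_coeff D \<alpha> \<mu> \<nu> z - v_coeff D \<alpha> \<nu> \<mu> z"

definition canonical_connection :: "'n::finite frame \<Rightarrow> 'n finsler_connection" where
  "canonical_connection l = Finsler_Connection (Gamma_can l) (barthel l) (C_can l)"

section \<open>FP-spaces\<close>

definition totally_symmetric3 :: "('n \<Rightarrow> 'n \<Rightarrow> 'n \<Rightarrow> real) \<Rightarrow> bool" where
  "totally_symmetric3 t \<longleftrightarrow>
     (\<forall>\<alpha> \<mu> \<nu>. t \<alpha> \<mu> \<nu> = t \<mu> \<alpha> \<nu> \<and> t \<alpha> \<mu> \<nu> = t \<alpha> \<nu> \<mu>)"

definition frame_in ::
  "('a, 'n::finite) chart set \<Rightarrow> ('a, 'n) chart \<Rightarrow> ('n \<Rightarrow> ('a, 'n) psection) \<Rightarrow> 'n frame" where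
  "frame_in \<A> c lam i = components \<A> c (lam i)"

definition FP_space ::
  "'a topology \<Rightarrow> ('a, 'n::finite) chart set \<Rightarrow> ('n \<Rightarrow> ('a, 'n) psection)
     \<Rightarrow> ('a \<Rightarrow> ('a, 'n) tvec \<Rightarrow> real) \<Rightarrow> bool" where
  "FP_space M \<A> lam F \<longleftrightarrow>
     smooth_manifold M \<A> \<and>
     (\<forall>i. smooth_section M \<A> (lam i)) \<and>
     (\<forall>p\<in>topspace M. \<forall>v \<in> tangent_space \<A> p - {zero_tvec}. \<forall>a :: 'n \<Rightarrow> real.
        (\<lambda>c. \<Sum>i\<in>UNIV. a i *\<^sub>R lam i p v c) = zero_tvec \<longrightarrow> (\<forall>i. a i = 0)) \<and>
     (\<forall>c\<in>\<A>. \<forall>z\<in>slit_domain c.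
        totally_symmetric3 (\<lambda>\<alpha> \<mu> \<nu>. dy \<alpha> (metric (frame_in \<A> c lam) \<mu> \<nu>) z)) \<and>
     (\<forall>i. \<forall>p\<in>topspace M. \<forall>v \<in> tangent_space \<A> p - {zero_tvec}. \<forall>t>0.
        lam i p (\<lambda>c. t *\<^sub>R v c) = lam i p v) \<and>
     (\<forall>c\<in>\<A>. \<forall>p\<in>fst c. \<forall>v \<in> tangent_space \<A> p - {zero_tvec}.
        F p v = sqrt (\<Sum>\<mu>\<in>UNIV. \<Sum>\<nu>\<in>UNIV.
          metric (frame_in \<A> c lam) \<mu> \<nu> (snd c p, v c) * v c $ \<mu> * v c $ \<nu>))"

end

theory Submission
  imports Defs
begin

text \<open>
  Three of the four torsion formulas merely unfold the definition of the canonical connection. The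
  formula for the \<open>(v)hv\<close>-torsion carries the content.

  Since \<open>C - B\<close> is the Cartan tensor \<open>C\<^sup>\<circ>\<close> and \<open>\<Gamma> - A\<close> is the Cartan horizontal connection
  \<open>\<Gamma>\<^sup>\<circ>\<close>, the bracket in the formula is the covariant derivative of \<open>C\<^sup>\<circ>\<close> with respect to
  \<open>\<Gamma>\<^sup>\<circ>\<close>: the terms in \<open>A\<close> exactly replace \<open>\<Gamma>\<close> by \<open>\<Gamma>\<^sup>\<circ>\<close> (lemma \<open>hcov_contortion\<close>). The claim is
  then the classical relation between the Berwald and the Cartan connection of a Finsler metric:
  the Berwald coefficients, that is the fibre derivatives of \<open>N\<close>, equal \<open>\<Gamma>\<^sup>\<circ>\<close> plus the derivative
  of \<open>C\<^sup>\<circ>\<close> in the direction \<open>y\<close> (lemma \<open>dy_barthel_eq\<close>).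

  To prove it, all indices are lowered, so that no derivative of the inverse metric appears.
  The lowered spray is a contraction of \<open>y\<close> twice with the lowered Christoffel symbols of the metric.
  One fibre derivative gives the lowered \<open>N\<close>, a second one gives the lowered Berwald
  coefficients. Homogeneity and total symmetry make every contraction of \<open>y\<close> with the fibre
  derivative of the metric vanish, and the same then holds after a further \<open>x\<close>-derivative; this
  kills most of the terms. Two consequences of the formula for \<open>N\<close> do the rest: contracting
  \<open>\<Gamma>\<^sup>\<circ>\<close> with \<open>y\<close> returns \<open>N\<close> (lemma \<open>Gamma_circ_fibre_contraction\<close>), and the derivative of
  the metric along the spray is the symmetrization of the lowered \<open>N\<close> (lemma
  \<open>delta_y_metric\<close>). With these, lowering the index of the derivative of \<open>C\<^sup>\<circ>\<close> yields the same expression as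
  lowering the difference between the Berwald coefficients and \<open>\<Gamma>\<^sup>\<circ>\<close>.

  The computation uses that second partial derivatives commute and that all objects are smooth.
  The latter rests on Cramer's rule, which makes the inverses of the matrices of the frame and of
  the metric smooth. The manifold enters only in passing from the FP-space to one chart, where
  homogeneity and linear independence have to be read off in coordinates.\<close>

section \<open>Calculus of smooth functions\<close>

text \<open>Openness matters: a derivative at a point of \<open>S\<close> depends on a full neighbourhood of the point.\<close>

lemma times_differentiable_on_cong:
  assumes "open S" "\<And>x. x \<in> S \<Longrightarrow> f x = g x"
  shows "times_differentiable_on k f S \<longleftrightarrow> times_differentiable_on k g S"
  using assms(2)
proof (induction k arbitrary: f g)
  case 0
  show ?case
    unfolding times_differentiable_on.simps by (rule continuous_on_cong[OF refl 0])
next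
  case (Suc k)
  have D: "(f has_derivative D) (at x) \<longleftrightarrow> (g has_derivative D) (at x)" if "x \<in> S" for x D
  proof
    assume "(f has_derivative D) (at x)"
    then show "(g has_derivative D) (at x)"
      by (rule has_derivative_transform_within_open[OF _ assms(1) that Suc.prems])
  next
    assume "(g has_derivative D) (at x)"
    then show "(f has_derivative D) (at x)"
      by (rule has_derivative_transform_within_open[OF _ assms(1) that Suc.prems[symmetric]])
  qed
  have 1: "f differentiable (at x) \<longleftrightarrow> g differentiable (at x)" if "x \<in> S" for x
    using D[OF that] unfolding differentiable_def by blast
  have 2: "frechet_derivative f (at x) v = frechet_derivative g (at x) v" if "x \<in> S" for x v
    using D[OF that] by (simp add: frechet_derivative_def)
  have 3: "times_differentiable_on k (\<lambda>x. frechet_derivative f (at x) v) S \<longleftrightarrow>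
      times_differentiable_on k (\<lambda>x. frechet_derivative g (at x) v) S" for v
    by (rule Suc.IH) (rule 2)
  show ?case
    unfolding times_differentiable_on.simps using 1 3 by blast
qed

lemma times_differentiable_on_SucD:
  "times_differentiable_on (Suc k) f S \<Longrightarrow> times_differentiable_on k f S"
proof (induction k arbitrary: f)
  case 0
  then have "\<forall>x\<in>S. f differentiable (at x)"
    unfolding times_differentiable_on.simps by (rule conjunct1)
  then have "\<forall>x\<in>S. isCont f x"
    using differentiable_imp_continuous_within by blast
  then have "continuous_on S f"
    by (rule continuous_at_imp_continuous_on)
  then show ?case
    by (simp only: times_differentiable_on.simps)
next
  case (Suc k)
  from Suc.prems have D: "\<forall>x\<in>S. f differentiable (at x)"
    and "\<forall>v. times_differentiable_on (Suc k) (\<lambda>x. frechet_derivative f (at x) v) S"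
    unfolding times_differentiable_on.simps(2)[of "Suc k"] by (rule conjunct1, rule conjunct2)
  then have "times_differentiable_on k (\<lambda>x. frechet_derivative f (at x) v) S" for v
    by (intro Suc.IH) (rule spec)
  with D show ?case
    unfolding times_differentiable_on.simps(2)[of k] by (intro conjI allI)
qed

text \<open>Trades \<^const>\<open>frechet_derivative\<close> for an explicit formula that is valid on \<open>S\<close>. The formulas for
  products and quotients are built from functions to which an induction hypothesis applies.\<close>

lemma times_differentiable_on_SucI:
  assumes "open S" "\<And>x. x \<in> S \<Longrightarrow> (f has_derivative f' x) (at x)"
    and "\<And>v. times_differentiable_on k (\<lambda>x. f' x v) S"
  shows "times_differentiable_on (Suc k) f S"
proof -
  have eq: "frechet_derivative f (at x) v = f' x v" if "x \<in> S" for x v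
    using frechet_derivative_at[OF assms(2)[OF that]] by simp
  have "times_differentiable_on k (\<lambda>x. frechet_derivative f (at x) v) S" for v
    by (subst times_differentiable_on_cong[OF assms(1) eq]) (simp_all add: assms(3))
  moreover have "\<forall>x\<in>S. f differentiable (at x)"
    using assms(2) differentiable_def by blast
  ultimately show ?thesis by simp
qed

lemma times_differentiable_on_SucE:
  assumes "times_differentiable_on (Suc k) f S" "x \<in> S"
  shows "(f has_derivative frechet_derivative f (at x)) (at x)"
  using assms by (simp add: frechet_derivative_works)

lemma times_differentiable_on_const: "open S \<Longrightarrow> times_differentiable_on k (\<lambda>x. c) S"
proof (induction k arbitrary: c)
  case (Suc k)
  then show ?case
    using times_differentiable_on_SucI[of S "\<lambda>x. c" "\<lambda>x v. 0" k] by simp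
qed auto

lemma times_differentiable_on_bounded_linear:
  assumes "open S" "bounded_linear h" "times_differentiable_on k f S"
  shows "times_differentiable_on k (\<lambda>x. h (f x)) S"
  using assms(3)
proof (induction k arbitrary: f)
  case 0
  then show ?case using assms(2) by (simp add: bounded_linear.continuous_on)
next
  case (Suc k)
  show ?case
  proof (rule times_differentiable_on_SucI[OF assms(1)])
    fix x assume "x \<in> S"
    then show "((\<lambda>x. h (f x)) has_derivative (\<lambda>v. h (frechet_derivative f (at x) v))) (at x)"
      by (intro bounded_linear.has_derivative[OF assms(2)] times_differentiable_on_SucE[OF Suc.prems])
  qed (use Suc in auto)
qed

lemma times_differentiable_on_ident: "open S \<Longrightarrow> times_differentiable_on k (\<lambda>x. x) S"
  by (cases k) (auto intro!: times_differentiable_on_const)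

lemma times_differentiable_on_add:
  assumes "open S" "times_differentiable_on k f S" "times_differentiable_on k g S"
  shows "times_differentiable_on k (\<lambda>x. f x + g x) S"
  using assms(2,3)
proof (induction k arbitrary: f g)
  case 0
  then show ?case by (simp add: continuous_intros)
next
  case (Suc k)
  show ?case
  proof (rule times_differentiable_on_SucI[OF assms(1)])
    fix x assume "x \<in> S"
    then show "((\<lambda>x. f x + g x) has_derivative
      (\<lambda>v. frechet_derivative f (at x) v + frechet_derivative g (at x) v)) (at x)"
      by (intro has_derivative_add times_differentiable_on_SucE[OF Suc.prems(1)]
          times_differentiable_on_SucE[OF Suc.prems(2)])
  qed (use Suc in auto)
qed

lemma times_differentiable_on_mult:
  fixes f g :: "_ \<Rightarrow> real"
  assumes "open S" "times_differentiable_on k f S" "times_differentiable_on k g S"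
  shows "times_differentiable_on k (\<lambda>x. f x * g x) S"
  using assms(2,3)
proof (induction k arbitrary: f g)
  case 0
  then show ?case by (simp add: continuous_intros)
next
  case (Suc k)
  show ?case
  proof (rule times_differentiable_on_SucI[OF assms(1)])
    fix x assume "x \<in> S"
    then show "((\<lambda>x. f x * g x) has_derivative
      (\<lambda>v. f x * frechet_derivative g (at x) v + frechet_derivative f (at x) v * g x)) (at x)"
      by (intro has_derivative_mult times_differentiable_on_SucE[OF Suc.prems(1)]
          times_differentiable_on_SucE[OF Suc.prems(2)])
  next
    fix v
    show "times_differentiable_on k
      (\<lambda>x. f x * frechet_derivative g (at x) v + frechet_derivative f (at x) v * g x) S"
      using Suc.prems times_differentiable_on_SucD[OF Suc.prems(1)]
        times_differentiable_on_SucD[OF Suc.prems(2)]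
      by (intro times_differentiable_on_add[OF assms(1)] Suc.IH) auto
  qed
qed

lemma times_differentiable_on_inverse:
  fixes f :: "_ \<Rightarrow> real"
  assumes "open S" "times_differentiable_on k f S" "\<And>x. x \<in> S \<Longrightarrow> f x \<noteq> 0"
  shows "times_differentiable_on k (\<lambda>x. inverse (f x)) S"
  using assms(2)
proof (induction k)
  case 0
  then show ?case using assms(3) by (simp add: continuous_intros)
next
  case (Suc k)
  show ?case
  proof (rule times_differentiable_on_SucI[OF assms(1)])
    fix x assume "x \<in> S"
    then show "((\<lambda>x. inverse (f x)) has_derivative
      (\<lambda>v. - 1 * (inverse (f x) * frechet_derivative f (at x) v * inverse (f x)))) (at x)"
      using Deriv.has_derivative_inverse[OF assms(3) times_differentiable_on_SucE[OF Suc.prems]] by simp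
  next
    fix v
    show "times_differentiable_on k
      (\<lambda>x. - 1 * (inverse (f x) * frechet_derivative f (at x) v * inverse (f x))) S"
      using Suc.prems Suc.IH[OF times_differentiable_on_SucD[OF Suc.prems]]
      by (intro times_differentiable_on_mult[OF assms(1)] times_differentiable_on_const[OF assms(1)]) auto
  qed
qed

lemma smooth_on_cong:
  assumes "open S" "\<And>x. x \<in> S \<Longrightarrow> f x = g x"
  shows "smooth_on f S \<longleftrightarrow> smooth_on g S"
  using times_differentiable_on_cong[OF assms] by (simp add: smooth_on_def)

lemma smooth_on_differentiable: "smooth_on f S \<Longrightarrow> x \<in> S \<Longrightarrow> f differentiable (at x)"
  using times_differentiable_on.simps(2)[of 0 f S] by (auto simp: smooth_on_def)

lemma smooth_on_has_derivative:
  "smooth_on f S \<Longrightarrow> x \<in> S \<Longrightarrow> (f has_derivative frechet_derivative f (at x)) (at x)"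
  by (simp add: smooth_on_differentiable flip: frechet_derivative_works)

lemma smooth_on_frechet_derivative:
  "smooth_on f S \<Longrightarrow> smooth_on (\<lambda>x. frechet_derivative f (at x) v) S"
  using times_differentiable_on.simps(2)[of _ f S] by (auto simp: smooth_on_def)

lemma smooth_on_continuous_on: "smooth_on f S \<Longrightarrow> continuous_on S f"
  using times_differentiable_on.simps(1)[of f S] by (auto simp: smooth_on_def)

lemma smooth_on_const: "open S \<Longrightarrow> smooth_on (\<lambda>x. c) S"
  by (simp add: smooth_on_def times_differentiable_on_const)

lemma smooth_on_bounded_linear:
  "open S \<Longrightarrow> bounded_linear h \<Longrightarrow> smooth_on f S \<Longrightarrow> smooth_on (\<lambda>x. h (f x)) S"
  by (simp add: smooth_on_def times_differentiable_on_bounded_linear)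

lemma smooth_on_ident: "open S \<Longrightarrow> smooth_on (\<lambda>x. x) S"
  by (simp add: smooth_on_def times_differentiable_on_ident)

lemma smooth_on_add:
  "open S \<Longrightarrow> smooth_on f S \<Longrightarrow> smooth_on g S \<Longrightarrow> smooth_on (\<lambda>x. f x + g x) S"
  by (simp add: smooth_on_def times_differentiable_on_add)

lemma smooth_on_mult:
  fixes f g :: "_ \<Rightarrow> real"
  shows "open S \<Longrightarrow> smooth_on f S \<Longrightarrow> smooth_on g S \<Longrightarrow> smooth_on (\<lambda>x. f x * g x) S"
  by (simp add: smooth_on_def times_differentiable_on_mult)

lemma smooth_on_diff:
  fixes f g :: "_ \<Rightarrow> real"
  assumes "open S" "smooth_on f S" "smooth_on g S"
  shows "smooth_on (\<lambda>x. f x - g x) S"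
  using smooth_on_add[OF assms(1,2) smooth_on_mult[OF assms(1) smooth_on_const[OF assms(1), of "-1"] assms(3)]]
  by simp

lemma smooth_on_divide:
  fixes f g :: "_ \<Rightarrow> real"
  assumes "open S" "smooth_on f S" "smooth_on g S" "\<And>x. x \<in> S \<Longrightarrow> g x \<noteq> 0"
  shows "smooth_on (\<lambda>x. f x / g x) S"
  using assms unfolding divide_inverse
  by (intro smooth_on_mult) (auto simp: smooth_on_def intro!: times_differentiable_on_inverse)

lemma smooth_on_sum:
  assumes "open S" "\<And>i. i \<in> I \<Longrightarrow> smooth_on (f i) S"
  shows "smooth_on (\<lambda>x. \<Sum>i\<in>I. f i x) S"
  using assms(2)
proof (induction I rule: infinite_finite_induct)
  case (insert i I)
  then show ?case by (simp add: smooth_on_add[OF assms(1)])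
qed (simp_all add: smooth_on_const[OF assms(1)])

lemma smooth_on_prod:
  fixes f :: "_ \<Rightarrow> _ \<Rightarrow> real"
  assumes "open S" "\<And>i. i \<in> I \<Longrightarrow> smooth_on (f i) S"
  shows "smooth_on (\<lambda>x. \<Prod>i\<in>I. f i x) S"
  using assms(2)
proof (induction I rule: infinite_finite_induct)
  case (insert i I)
  then show ?case by (simp add: smooth_on_mult[OF assms(1)])
qed (simp_all add: smooth_on_const[OF assms(1)])

lemma smooth_on_det:
  fixes A :: "'n::finite \<Rightarrow> 'n \<Rightarrow> 'a::real_normed_vector \<Rightarrow> real"
  assumes "open S" "\<And>i j. smooth_on (A i j) S"
  shows "smooth_on (\<lambda>x. det (\<chi> i j. A i j x)) S"
  unfolding det_def
  by (simp, intro smooth_on_sum smooth_on_mult smooth_on_prod smooth_on_const assms)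

lemma matrix_inv_inverse:
  fixes A :: "real ^ 'n ^ 'n"
  assumes "invertible A"
  shows "A ** matrix_inv A = mat 1" "matrix_inv A ** A = mat 1"
  using someI_ex[OF assms[unfolded invertible_def]] by (simp_all add: matrix_inv_def)

text \<open>Cramer's rule displays the entries of the inverse as rational functions of the entries of the
  matrix, whence their smoothness.\<close>

lemma matrix_inv_cramer:
  fixes A :: "real ^ 'n ^ 'n"
  assumes "invertible A"
  shows "matrix_inv A $ k $ m =
    det (\<chi> i j. if j = k then (if i = m then 1 else 0) else A $ i $ j) / det A"
proof -
  have "A ** matrix_inv A = mat 1"
    using assms by (rule matrix_inv_inverse)
  then have "A *v (matrix_inv A *v axis m 1) = axis m 1"
    by (simp add: matrix_vector_mul_assoc)
  then have "matrix_inv A *v axis m 1 =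
     (\<chi> k. det (\<chi> i j. if j = k then axis m 1 $ i else A $ i $ j) / det A)"
    using cramer[of A] assms by (simp add: invertible_det_nz)
  then have "(matrix_inv A *v axis m 1) $ k =
     det (\<chi> i j. if j = k then axis m 1 $ i else A $ i $ j) / det A"
    by simp
  moreover have "(matrix_inv A *v axis m 1) $ k = matrix_inv A $ k $ m"
    by (simp add: matrix_vector_mult_def axis_def if_distrib[where f="\<lambda>x. _ * x"] cong: if_cong)
  ultimately show ?thesis by (simp add: axis_def eq_commute cong: if_cong)
qed

lemma smooth_on_matrix_inv:
  fixes A :: "'n::finite \<Rightarrow> 'n \<Rightarrow> 'a::real_normed_vector \<Rightarrow> real"
  assumes "open S" "\<And>i j. smooth_on (A i j) S" "\<And>x. x \<in> S \<Longrightarrow> invertible (\<chi> i j. A i j x)"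
  shows "smooth_on (\<lambda>x. matrix_inv (\<chi> i j. A i j x) $ k $ m) S"
proof -
  have "smooth_on (\<lambda>x. det (\<chi> i j. (if j = k then (\<lambda>x. if i = m then 1 else 0) else A i j) x)
      / det (\<chi> i j. A i j x)) S"
    using assms by (intro smooth_on_divide smooth_on_det) (auto simp: invertible_det_nz smooth_on_const)
  then show ?thesis
    by (rule smooth_on_cong[THEN iffD1, rotated 2])
      (use assms in \<open>auto simp: matrix_inv_cramer if_distrib[where f="\<lambda>f. f _"] cong: if_cong\<close>)
qed

section \<open>Symmetry of second derivatives\<close>

lemma smooth_on_has_derivative_along_line:
  fixes f :: "'a::real_normed_vector \<Rightarrow> real"
  assumes "smooth_on f S" "p + t *\<^sub>R u \<in> S"
  shows "((\<lambda>t. f (p + t *\<^sub>R u)) has_real_derivative frechet_derivative f (at (p + t *\<^sub>R u)) u) (at t)"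
proof -
  let ?D = "frechet_derivative f (at (p + t *\<^sub>R u))"
  have D: "(f has_derivative ?D) (at (p + t *\<^sub>R u))"
    using assms by (rule smooth_on_has_derivative)
  have "((\<lambda>t. p + t *\<^sub>R u) has_derivative (\<lambda>s. s *\<^sub>R u)) (at t)"
    by (auto intro!: derivative_eq_intros)
  from has_derivative_compose[OF this D]
  have "((\<lambda>t. f (p + t *\<^sub>R u)) has_derivative (\<lambda>s. ?D (s *\<^sub>R u))) (at t)" .
  moreover have "?D (s *\<^sub>R u) = ?D u * s" for s
    using linear_cmul[OF has_derivative_linear[OF D], of s u] by simp
  ultimately show ?thesis by (simp add: has_field_derivative_def)
qed

text \<open>The left-hand side of the equation is symmetric in \<open>u\<close> and \<open>v\<close>, the right-hand side is a mixed
  second derivative in a prescribed order. The formula comes from applying the mean value theorem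
  first in the direction \<open>u\<close> and then in the direction \<open>v\<close>.\<close>

lemma second_difference_mean_value:
  fixes f :: "'a::real_normed_vector \<Rightarrow> real"
  assumes smooth: "smooth_on f S" and "h > 0"
    and S: "\<And>s t. 0 \<le> s \<Longrightarrow> s \<le> h \<Longrightarrow> 0 \<le> t \<Longrightarrow> t \<le> h \<Longrightarrow> z + s *\<^sub>R u + t *\<^sub>R v \<in> S"
  obtains s t where "0 \<le> s" "s \<le> h" "0 \<le> t" "t \<le> h"
    "f (z + h *\<^sub>R u + h *\<^sub>R v) - f (z + h *\<^sub>R u) - f (z + h *\<^sub>R v) + f z =
     h * h * frechet_derivative (\<lambda>x. frechet_derivative f (at x) u) (at (z + s *\<^sub>R u + t *\<^sub>R v)) v"
proof -
  let ?Du = "\<lambda>x. frechet_derivative f (at x) u"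
  let ?\<phi> = "\<lambda>s. f (z + h *\<^sub>R v + s *\<^sub>R u) - f (z + s *\<^sub>R u)"
  have "(?\<phi> has_real_derivative ?Du (z + h *\<^sub>R v + s *\<^sub>R u) - ?Du (z + s *\<^sub>R u)) (at s)"
    if "0 \<le> s" "s \<le> h" for s
    using S[OF that, of 0] S[OF that, of h] \<open>h > 0\<close>
    by (intro DERIV_diff smooth_on_has_derivative_along_line[OF smooth]) (simp_all add: algebra_simps)
  from MVT2[OF \<open>h > 0\<close> this] obtain s where s: "0 < s" "s < h"
    "?\<phi> h - ?\<phi> 0 = h * (?Du (z + h *\<^sub>R v + s *\<^sub>R u) - ?Du (z + s *\<^sub>R u))"
    by auto
  have "((\<lambda>t. ?Du (z + s *\<^sub>R u + t *\<^sub>R v)) has_real_derivative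
      frechet_derivative ?Du (at (z + s *\<^sub>R u + t *\<^sub>R v)) v) (at t)"
    if "0 \<le> t" "t \<le> h" for t
    using S[of s t] s that
    by (intro smooth_on_has_derivative_along_line[OF smooth_on_frechet_derivative[OF smooth]]) auto
  from MVT2[OF \<open>h > 0\<close> this] obtain t where t: "0 < t" "t < h"
    "?Du (z + s *\<^sub>R u + h *\<^sub>R v) - ?Du (z + s *\<^sub>R u) =
     h * frechet_derivative ?Du (at (z + s *\<^sub>R u + t *\<^sub>R v)) v"
    by auto
  have "?\<phi> h - ?\<phi> 0 = h * (h * frechet_derivative ?Du (at (z + s *\<^sub>R u + t *\<^sub>R v)) v)"
    using s(3) t(3) by (simp add: add.commute add.left_commute)
  then show ?thesis
    using s t that[of s t] by (simp add: algebra_simps)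
qed

text \<open>By the previous lemma, applied to \<open>u\<close> and \<open>v\<close> in both orders, every neighbourhood of \<open>z\<close> has a
  point where one mixed derivative takes the value that the other one takes at a second such point;
  continuity of both derivatives excludes different values at \<open>z\<close>.\<close>

lemma smooth_on_derivatives_commute:
  fixes f :: "'a::real_normed_vector \<Rightarrow> real"
  assumes "open S" and smooth: "smooth_on f S" and "z \<in> S"
  shows "frechet_derivative (\<lambda>x. frechet_derivative f (at x) u) (at z) v =
         frechet_derivative (\<lambda>x. frechet_derivative f (at x) v) (at z) u"
    (is "?P z = ?Q z")
proof (rule ccontr)
  assume neq: "?P z \<noteq> ?Q z"
  define e where "e = \<bar>?P z - ?Q z\<bar> / 2"
  have "e > 0" using neq by (simp add: e_def)
  have "isCont ?P z" "isCont ?Q z"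
    using smooth_on_continuous_on[OF smooth_on_frechet_derivative[OF smooth_on_frechet_derivative[OF smooth]]]
      \<open>open S\<close> \<open>z \<in> S\<close> by (auto simp: continuous_on_eq_continuous_at)
  then obtain d1 d2 where d12: "d1 > 0" "\<And>x. dist x z < d1 \<Longrightarrow> dist (?P x) (?P z) < e"
      "d2 > 0" "\<And>x. dist x z < d2 \<Longrightarrow> dist (?Q x) (?Q z) < e"
    using \<open>e > 0\<close> unfolding continuous_at_eps_delta dist_norm by metis
  obtain d3 where d3: "d3 > 0" "ball z d3 \<subseteq> S"
    using \<open>open S\<close> \<open>z \<in> S\<close> open_contains_ball by blast
  define d where "d = min d1 (min d2 d3)"
  have "d > 0" using d12 d3 by (simp add: d_def)
  \<comment> \<open>The denominator keeps the parallelogram with sides \<open>h u\<close> and \<open>h v\<close> inside the ball of radius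
    \<open>d\<close>; the summand 1 avoids division by zero.\<close>
  define h where "h = d / (norm u + norm v + 1)"
  have pos: "norm u + norm v + 1 > 0" by (simp add: add_nonneg_pos)
  then have "h > 0" using \<open>d > 0\<close> by (simp add: h_def)
  have "h * (norm u + norm v + 1) = d" using pos by (simp add: h_def)
  then have h: "h * norm u + h * norm v < d" using \<open>h > 0\<close> by (simp add: algebra_simps)
  have near: "dist (z + s *\<^sub>R u + t *\<^sub>R v) z < d" if "0 \<le> s" "s \<le> h" "0 \<le> t" "t \<le> h" for s t
  proof -
    have "norm (s *\<^sub>R u + t *\<^sub>R v) \<le> s * norm u + t * norm v"
      using norm_triangle_ineq[of "s *\<^sub>R u" "t *\<^sub>R v"] that by simp
    also have "\<dots> \<le> h * norm u + h * norm v"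
      using that by (intro add_mono mult_right_mono) auto
    finally show ?thesis using h by (simp add: dist_norm add.assoc)
  qed
  have inS: "z + s *\<^sub>R u + t *\<^sub>R v \<in> S" if "0 \<le> s" "s \<le> h" "0 \<le> t" "t \<le> h" for s t
    using near[OF that] d3 by (auto simp: d_def dist_commute)
  have inS': "z + s *\<^sub>R v + t *\<^sub>R u \<in> S" if "0 \<le> s" "s \<le> h" "0 \<le> t" "t \<le> h" for s t
    using inS[of t s] that by (simp add: algebra_simps)
  obtain s t where st: "0 \<le> s" "s \<le> h" "0 \<le> t" "t \<le> h"
    and P: "f (z + h *\<^sub>R u + h *\<^sub>R v) - f (z + h *\<^sub>R u) - f (z + h *\<^sub>R v) + f z =
      h * h * ?P (z + s *\<^sub>R u + t *\<^sub>R v)"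
    using second_difference_mean_value[OF smooth \<open>h > 0\<close> inS] by blast
  obtain s' t' where st': "0 \<le> s'" "s' \<le> h" "0 \<le> t'" "t' \<le> h"
    and Q: "f (z + h *\<^sub>R v + h *\<^sub>R u) - f (z + h *\<^sub>R v) - f (z + h *\<^sub>R u) + f z =
      h * h * ?Q (z + s' *\<^sub>R v + t' *\<^sub>R u)"
    using second_difference_mean_value[OF smooth \<open>h > 0\<close> inS'] by blast
  have "z + h *\<^sub>R u + h *\<^sub>R v = z + h *\<^sub>R v + h *\<^sub>R u" by simp
  then have "h * h * ?P (z + s *\<^sub>R u + t *\<^sub>R v) = h * h * ?Q (z + s' *\<^sub>R v + t' *\<^sub>R u)"
    using P Q by (simp only:)
  then have "?P (z + s *\<^sub>R u + t *\<^sub>R v) = ?Q (z + s' *\<^sub>R v + t' *\<^sub>R u)"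
    using \<open>h > 0\<close> by simp
  moreover have "dist (?P (z + s *\<^sub>R u + t *\<^sub>R v)) (?P z) < e"
    using near[OF st] by (intro d12(2)) (simp add: d_def)
  moreover have "dist (z + s' *\<^sub>R v + t' *\<^sub>R u) z < d2"
    using near[of t' s'] st' by (simp add: d_def add.assoc add.commute[of "s' *\<^sub>R v"])
  then have "dist (?Q (z + s' *\<^sub>R v + t' *\<^sub>R u)) (?Q z) < e"
    by (rule d12(4))
  ultimately have "\<bar>?P z - ?Q z\<bar> < 2 * e"
    unfolding dist_real_def by linarith
  then show False by (simp add: e_def)
qed


section \<open>Derivatives in the induced coordinates\<close>

lemma frechet_derivative_add:
  assumes "f differentiable (at z)" "g differentiable (at z)"
  shows "frechet_derivative (\<lambda>z. f z + g z) (at z) v =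
    frechet_derivative f (at z) v + frechet_derivative g (at z) v"
  using frechet_derivative_at[OF has_derivative_add[OF assms[unfolded frechet_derivative_works]]]
  by metis

lemma frechet_derivative_diff:
  assumes "f differentiable (at z)" "g differentiable (at z)"
  shows "frechet_derivative (\<lambda>z. f z - g z) (at z) v =
    frechet_derivative f (at z) v - frechet_derivative g (at z) v"
  using frechet_derivative_at[OF has_derivative_diff[OF assms[unfolded frechet_derivative_works]]]
  by metis

lemma frechet_derivative_mult:
  fixes f g :: "_ \<Rightarrow> real"
  assumes "f differentiable (at z)" "g differentiable (at z)"
  shows "frechet_derivative (\<lambda>z. f z * g z) (at z) v =
    f z * frechet_derivative g (at z) v + frechet_derivative f (at z) v * g z"
  using frechet_derivative_at[OF has_derivative_mult[OF assms[unfolded frechet_derivative_works]]]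
  by metis

lemma frechet_derivative_sum:
  assumes "\<And>i. i \<in> I \<Longrightarrow> f i differentiable (at z)"
  shows "frechet_derivative (\<lambda>z. \<Sum>i\<in>I. f i z) (at z) v = (\<Sum>i\<in>I. frechet_derivative (f i) (at z) v)"
proof -
  have "((\<lambda>z. \<Sum>i\<in>I. f i z) has_derivative (\<lambda>v. \<Sum>i\<in>I. frechet_derivative (f i) (at z) v)) (at z)"
    using assms by (intro has_derivative_sum) (simp add: frechet_derivative_works)
  from frechet_derivative_at[OF this] show ?thesis by metis
qed

lemma frechet_derivative_cong_open:
  assumes "open S" "z \<in> S" "\<And>w. w \<in> S \<Longrightarrow> f w = g w" "f differentiable (at z)"
  shows "frechet_derivative f (at z) v = frechet_derivative g (at z) v"
  using frechet_derivative_transform_within_open[OF assms(4,1,2,3)] by simp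

lemma frechet_derivative_fibre_coordinate:
  "frechet_derivative (\<lambda>z::'n::finite coord. snd z $ \<kappa>) (at z) v = snd v $ \<kappa>"
proof -
  have "((\<lambda>z::'n coord. snd z $ \<kappa>) has_derivative (\<lambda>v. snd v $ \<kappa>)) (at z)"
    by (intro bounded_linear_imp_has_derivative bounded_linear_compose[OF bounded_linear_vec_nth bounded_linear_snd])
  from frechet_derivative_at[OF this] show ?thesis by metis
qed

lemma differentiable_fibre_coordinate: "(\<lambda>z::'n::finite coord. snd z $ \<kappa>) differentiable (at z)"
  by (intro bounded_linear_imp_differentiable bounded_linear_compose[OF bounded_linear_vec_nth bounded_linear_snd])

lemma coordinate_derivative_rules:
  fixes f g :: "'n::finite coord \<Rightarrow> real"
  assumes "f differentiable (at z)" "g differentiable (at z)"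
  shows "dx \<mu> (\<lambda>z. f z + g z) z = dx \<mu> f z + dx \<mu> g z"
    and "dx \<mu> (\<lambda>z. f z - g z) z = dx \<mu> f z - dx \<mu> g z"
    and "dx \<mu> (\<lambda>z. f z * g z) z = f z * dx \<mu> g z + dx \<mu> f z * g z"
    and "dy \<mu> (\<lambda>z. f z + g z) z = dy \<mu> f z + dy \<mu> g z"
    and "dy \<mu> (\<lambda>z. f z - g z) z = dy \<mu> f z - dy \<mu> g z"
    and "dy \<mu> (\<lambda>z. f z * g z) z = f z * dy \<mu> g z + dy \<mu> f z * g z"
  using assms
  by (simp_all add: dx_def dy_def frechet_derivative_add frechet_derivative_diff frechet_derivative_mult)

lemma coordinate_derivative_scale:
  fixes f :: "'n::finite coord \<Rightarrow> real"
  assumes "f differentiable (at z)"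
  shows "dx \<mu> (\<lambda>z. a * f z) z = a * dx \<mu> f z"
    and "dy \<mu> (\<lambda>z. a * f z) z = a * dy \<mu> f z"
  using frechet_derivative_mult[of "\<lambda>z. a" z f] assms by (simp_all add: dx_def dy_def)

lemma coordinate_derivative_sum:
  fixes f :: "'i \<Rightarrow> 'n::finite coord \<Rightarrow> real"
  assumes "\<And>i. i \<in> I \<Longrightarrow> f i differentiable (at z)"
  shows "dx \<mu> (\<lambda>z. \<Sum>i\<in>I. f i z) z = (\<Sum>i\<in>I. dx \<mu> (f i) z)"
    and "dy \<mu> (\<lambda>z. \<Sum>i\<in>I. f i z) z = (\<Sum>i\<in>I. dy \<mu> (f i) z)"
  using frechet_derivative_sum[OF assms] by (simp_all add: dx_def dy_def)

lemma coordinate_derivative_cong: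
  fixes f g :: "'n::finite coord \<Rightarrow> real"
  assumes "open S" "z \<in> S" "\<And>w. w \<in> S \<Longrightarrow> f w = g w" "f differentiable (at z)"
  shows "dx \<mu> f z = dx \<mu> g z" and "dy \<mu> f z = dy \<mu> g z"
  using frechet_derivative_cong_open[OF assms] by (simp_all add: dx_def dy_def)

lemma derivative_fibre_coordinate:
  "dx \<mu> (\<lambda>z. snd z $ \<kappa>) z = 0" "dy \<mu> (\<lambda>z. snd z $ \<kappa>) z = (if \<kappa> = \<mu> then 1 else 0)"
  by (simp_all add: dx_def dy_def frechet_derivative_fibre_coordinate axis_def)

lemma smooth_on_coordinate_derivative:
  fixes f :: "'n::finite coord \<Rightarrow> real"
  assumes "smooth_on f S"
  shows "smooth_on (dx \<mu> f) S" "smooth_on (dy \<mu> f) S"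
  using smooth_on_frechet_derivative[OF assms] by (simp_all add: dx_def[abs_def] dy_def[abs_def])

lemma smooth_on_fibre_coordinate: "open S \<Longrightarrow> smooth_on (\<lambda>z::'n::finite coord. snd z $ \<kappa>) S"
  by (rule smooth_on_bounded_linear[OF _ bounded_linear_compose[OF bounded_linear_vec_nth bounded_linear_snd]
        smooth_on_ident])

lemma coordinate_derivatives_commute:
  fixes f :: "'n::finite coord \<Rightarrow> real"
  assumes "open S" "smooth_on f S" "z \<in> S"
  shows "dy \<nu> (dx \<mu> f) z = dx \<mu> (dy \<nu> f) z" and "dy \<nu> (dy \<mu> f) z = dy \<mu> (dy \<nu> f) z"
  using smooth_on_derivatives_commute[OF assms] by (simp_all add: dx_def[abs_def] dy_def[abs_def])

section \<open>Geometry in a coordinate domain\<close>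

text \<open>The Christoffel symbols of the first kind of the metric at fixed \<open>y\<close>.\<close>

definition christoffel_low :: "'n::finite frame \<Rightarrow> 'n \<Rightarrow> 'n \<Rightarrow> 'n \<Rightarrow> 'n coord \<Rightarrow> real" where
  "christoffel_low l \<eta> \<mu> \<nu> z =
     1 / 2 * (dx \<mu> (metric l \<nu> \<eta>) z + dx \<nu> (metric l \<mu> \<eta>) z - dx \<eta> (metric l \<mu> \<nu>) z)"

text \<open>The horizontal derivative in the direction of the fibre coordinate. In an FP-space it is the
  derivative along the spray (lemma \<open>delta_y_eq\<close>).\<close>

definition delta_y :: "'n::finite frame \<Rightarrow> ('n coord \<Rightarrow> real) \<Rightarrow> 'n coord \<Rightarrow> real" where
  "delta_y l f z = (\<Sum>\<beta>\<in>UNIV. snd z $ \<beta> * delta l \<beta> f z)"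

lemma contraction_assoc:
  fixes a b :: "_ \<Rightarrow> real"
  shows "(\<Sum>\<alpha>\<in>UNIV. a \<alpha> * (\<Sum>\<rho>\<in>UNIV. X \<alpha> \<rho> * b \<rho>)) = (\<Sum>\<rho>\<in>UNIV. (\<Sum>\<alpha>\<in>UNIV. a \<alpha> * X \<alpha> \<rho>) * b \<rho>)"
  unfolding sum_distrib_left sum_distrib_right
  by (subst sum.swap) (simp add: mult.assoc)

lemma metric_commute: "metric l \<mu> \<nu> = metric l \<nu> \<mu>"
  by (rule ext) (simp add: metric_def mult.commute)

lemma christoffel_low_commute: "christoffel_low l \<eta> \<mu> \<nu> z = christoffel_low l \<eta> \<nu> \<mu> z"
  by (simp add: christoffel_low_def metric_commute[of l \<mu> \<nu>])

text \<open>What remains of an FP-space in one chart: the frame components are smooth, invertible and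
  homogeneous of degree zero on an open set of pairs \<open>(x, y)\<close>, and the fibre derivative of the
  metric is symmetric.\<close>

locale fp_coordinates =
  fixes S :: "('n::finite) coord set" and l :: "'n frame"
  assumes open_S: "open S"
    and smooth_frame: "smooth_on (l i) S"
    and invertible_frame: "z \<in> S \<Longrightarrow> invertible (\<chi> i \<alpha>. frame_up l i \<alpha> z)"
    and cartan_symmetric: "z \<in> S \<Longrightarrow> totally_symmetric3 (\<lambda>\<alpha> \<mu> \<nu>. dy \<alpha> (metric l \<mu> \<nu>) z)"
    and frame_homogeneous: "z \<in> S \<Longrightarrow> t > 0 \<Longrightarrow> l i (fst z, t *\<^sub>R snd z) = l i z"
begin

subsection \<open>Smoothness of the geometric objects\<close>

lemmas smooth_intros =
  smooth_on_sum[OF open_S] smooth_on_mult[OF open_S] smooth_on_add[OF open_S]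
  smooth_on_diff[OF open_S] smooth_on_const[OF open_S] smooth_on_coordinate_derivative
  smooth_on_fibre_coordinate[OF open_S]

lemma smooth_frame_up: "smooth_on (frame_up l i \<alpha>) S"
  unfolding frame_up_def[abs_def]
  by (rule smooth_on_bounded_linear[OF open_S bounded_linear_vec_nth smooth_frame])

lemma smooth_frame_low: "smooth_on (frame_low l i \<alpha>) S"
  unfolding frame_low_def[abs_def]
  by (intro smooth_on_matrix_inv open_S smooth_frame_up invertible_frame)

lemma smooth_metric: "smooth_on (metric l \<mu> \<nu>) S"
  unfolding metric_def[abs_def] by (intro smooth_intros smooth_frame_low)

text \<open>As a matrix, the metric is the product of the inverse frame matrix and its transpose.\<close>

lemma invertible_metric:
  assumes "z \<in> S"
  shows "invertible (\<chi> \<mu> \<nu>. metric l \<mu> \<nu> z)"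
proof -
  let ?U = "\<chi> i \<alpha>. frame_up l i \<alpha> z"
  let ?L = "matrix_inv ?U"
  have "invertible ?L"
    using matrix_inv_inverse[OF invertible_frame[OF assms]] unfolding invertible_def by blast
  moreover have "(\<chi> \<mu> \<nu>. metric l \<mu> \<nu> z) = ?L ** transpose ?L"
    by (simp add: vec_eq_iff matrix_matrix_mult_def transpose_def metric_def frame_low_def)
  ultimately show ?thesis by (simp add: invertible_det_nz det_mul)
qed

lemma smooth_metric_inv: "smooth_on (metric_inv l \<mu> \<nu>) S"
  unfolding metric_inv_def[abs_def]
  by (intro smooth_on_matrix_inv open_S smooth_metric invertible_metric)

lemma smooth_christoffel_low: "smooth_on (christoffel_low l \<eta> \<mu> \<nu>) S"
  unfolding christoffel_low_def[abs_def] by (intro smooth_intros smooth_metric)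

lemma smooth_spray: "smooth_on (spray l \<alpha>) S"
  unfolding spray_def[abs_def] christoffel_def[abs_def]
  by (intro smooth_intros smooth_metric smooth_metric_inv)

lemma smooth_barthel: "smooth_on (barthel l \<alpha> \<beta>) S"
  unfolding barthel_def[abs_def] by (intro smooth_on_coordinate_derivative smooth_spray)

lemma smooth_C_can: "smooth_on (C_can l \<alpha> \<mu> \<nu>) S"
  unfolding C_can_def[abs_def] by (intro smooth_intros smooth_frame_up smooth_frame_low)

lemma smooth_C_circ: "smooth_on (C_circ l \<alpha> \<mu> \<nu>) S"
  unfolding C_circ_def[abs_def] by (intro smooth_intros smooth_metric smooth_metric_inv)

lemmas diff_smooth = smooth_on_differentiable[where S=S]

subsection \<open>Raising and lowering indices\<close>

lemma metric_inverse:
  assumes "z \<in> S"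
  shows "(\<Sum>\<alpha>\<in>UNIV. metric l \<eta> \<alpha> z * metric_inv l \<alpha> \<sigma> z) = (if \<eta> = \<sigma> then 1 else 0)"
    and "(\<Sum>\<alpha>\<in>UNIV. metric_inv l \<eta> \<alpha> z * metric l \<alpha> \<sigma> z) = (if \<eta> = \<sigma> then 1 else 0)"
  using matrix_inv_inverse[OF invertible_metric[OF assms]]
  by (simp_all add: vec_eq_iff matrix_matrix_mult_def mat_def metric_inv_def)

lemma lower_raised:
  assumes "z \<in> S"
  shows "(\<Sum>\<alpha>\<in>UNIV. metric l \<eta> \<alpha> z * (\<Sum>\<sigma>\<in>UNIV. metric_inv l \<alpha> \<sigma> z * T \<sigma>)) = T \<eta>"
  by (simp add: contraction_assoc metric_inverse[OF assms] if_distrib[where f="\<lambda>x. x * _"] cong: if_cong)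

text \<open>The Christoffel symbols, \<open>\<Gamma>\<^sup>\<circ>\<close> and \<open>C\<^sup>\<circ>\<close> all have the shape of the raised term with the factor
  one half.\<close>

lemma lower_half_raised:
  assumes "z \<in> S"
  shows "(\<Sum>\<alpha>\<in>UNIV. metric l \<eta> \<alpha> z * (1 / 2 * (\<Sum>\<sigma>\<in>UNIV. metric_inv l \<alpha> \<sigma> z * T \<sigma>))) = 1 / 2 * T \<eta>"
  using lower_raised[OF assms, of \<eta> T] by (simp flip: sum_divide_distrib)

text \<open>This allows every identity between objects with an upper index to be proved in lowered form.\<close>

lemma lower_injective:
  assumes "z \<in> S"
    and "\<And>\<eta>. (\<Sum>\<alpha>\<in>UNIV. metric l \<eta> \<alpha> z * X \<alpha>) = (\<Sum>\<alpha>\<in>UNIV. metric l \<eta> \<alpha> z * Y \<alpha>)"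
  shows "X \<alpha> = Y \<alpha>"
proof -
  have "(\<Sum>\<eta>\<in>UNIV. metric_inv l \<alpha> \<eta> z * (\<Sum>\<sigma>\<in>UNIV. metric l \<eta> \<sigma> z * Z \<sigma>)) = Z \<alpha>" for Z
    by (simp add: contraction_assoc metric_inverse[OF assms(1)] if_distrib[where f="\<lambda>x. x * _"] cong: if_cong)
  from this[of X] this[of Y] show ?thesis using assms(2) by simp
qed

subsection \<open>Homogeneity and the fibre derivative of the metric\<close>

lemma cartan_swap:
  assumes "z \<in> S"
  shows "dy \<alpha> (metric l \<mu> \<nu>) z = dy \<mu> (metric l \<alpha> \<nu>) z"
  using cartan_symmetric[OF assms] unfolding totally_symmetric3_def by blast

lemma metric_homogeneous:
  assumes "z \<in> S" "t > 0"
  shows "metric l \<mu> \<nu> (fst z, t *\<^sub>R snd z) = metric l \<mu> \<nu> z"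
  using frame_homogeneous[OF assms] by (simp add: metric_def frame_low_def frame_up_def)

text \<open>The metric is constant along the ray \<open>t \<mapsto> (x, t y)\<close>, so that its derivative in the direction
  \<open>(0, y)\<close> vanishes.\<close>

lemma euler_metric:
  assumes "z \<in> S"
  shows "(\<Sum>\<alpha>\<in>UNIV. snd z $ \<alpha> * dy \<alpha> (metric l \<mu> \<nu>) z) = 0"
proof -
  let ?g = "metric l \<mu> \<nu>" and ?v = "(0 :: real ^ 'n, snd z)"
  let ?D = "frechet_derivative ?g (at z)"
  have z: "z + t *\<^sub>R ?v = (fst z, (1 + t) *\<^sub>R snd z)" for t
    by (simp add: prod_eq_iff algebra_simps)
  have "((\<lambda>t. ?g (z + t *\<^sub>R ?v)) has_real_derivative ?D ?v) (at 0)"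
    using smooth_on_has_derivative_along_line[OF smooth_metric, of z 0 ?v] assms
    by (simp flip: zero_prod_def)
  then have "((\<lambda>t. ?g z) has_real_derivative ?D ?v) (at 0)"
  proof (rule has_field_derivative_transform_within_open[of _ _ _ "{-1<..}"])
    fix t :: real assume "t \<in> {-1<..}"
    then show "?g (z + t *\<^sub>R ?v) = ?g z"
      unfolding z by (intro metric_homogeneous[OF assms]) simp
  qed auto
  then have "?D ?v = 0" by (rule DERIV_unique) simp
  moreover have "?v = (\<Sum>\<alpha>\<in>UNIV. snd z $ \<alpha> *\<^sub>R (0, axis \<alpha> 1))"
    using basis_expansion[of "snd z"]
    by (simp add: prod_eq_iff fst_sum snd_sum scalar_mult_eq_scaleR)
  moreover have "linear ?D"
    by (rule linear_frechet_derivative[OF diff_smooth[OF smooth_metric assms]])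
  ultimately show ?thesis
    by (simp only: linear_sum linear_cmul dy_def real_scaleR_def)
qed

text \<open>Total symmetry moves the slot contracted in Euler's relation to any other place.\<close>

lemma cartan_fibre_contraction:
  assumes "z \<in> S"
  shows "(\<Sum>\<nu>\<in>UNIV. dy \<alpha> (metric l \<nu> \<mu>) z * snd z $ \<nu>) = 0"
    and "(\<Sum>\<nu>\<in>UNIV. dy \<alpha> (metric l \<mu> \<nu>) z * snd z $ \<nu>) = 0"
  using euler_metric[OF assms, of \<alpha> \<mu>]
  by (simp_all add: cartan_swap[OF assms, of \<alpha>] metric_commute[of l \<mu>] mult.commute)

text \<open>The fibre coordinate does not depend on \<open>x\<close>, so the vanishing contraction may be differentiated
  under the sum.\<close>

lemma dx_cartan_fibre_contraction:
  assumes "z \<in> S"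
  shows "(\<Sum>\<nu>\<in>UNIV. dx \<kappa> (dy \<alpha> (metric l \<nu> \<mu>)) z * snd z $ \<nu>) = 0"
    and "(\<Sum>\<nu>\<in>UNIV. dx \<kappa> (dy \<alpha> (metric l \<mu> \<nu>)) z * snd z $ \<nu>) = 0"
proof -
  note sm = smooth_on_coordinate_derivative(2)[OF smooth_metric]
  have "dx \<kappa> (\<lambda>z. \<Sum>\<nu>\<in>UNIV. dy \<alpha> (metric l \<nu> \<mu>) z * snd z $ \<nu>) z = dx \<kappa> (\<lambda>z. 0) z"
    by (rule coordinate_derivative_cong[OF open_S assms])
      (auto intro!: cartan_fibre_contraction(1) diff_smooth[OF _ assms] smooth_intros smooth_metric)
  then show "(\<Sum>\<nu>\<in>UNIV. dx \<kappa> (dy \<alpha> (metric l \<nu> \<mu>)) z * snd z $ \<nu>) = 0"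
    by (simp add: coordinate_derivative_sum coordinate_derivative_rules derivative_fibre_coordinate
        differentiable_fibre_coordinate diff_smooth[OF sm assms] dx_def[of \<kappa> "\<lambda>z. 0"])
  then show "(\<Sum>\<nu>\<in>UNIV. dx \<kappa> (dy \<alpha> (metric l \<mu> \<nu>)) z * snd z $ \<nu>) = 0"
    by (simp add: metric_commute[of l \<mu>])
qed


subsection \<open>The spray and the Barthel connection with a lowered index\<close>

lemma lower_christoffel:
  assumes "z \<in> S"
  shows "(\<Sum>\<alpha>\<in>UNIV. metric l \<eta> \<alpha> z * christoffel l \<alpha> \<mu> \<nu> z) = christoffel_low l \<eta> \<mu> \<nu> z"
  unfolding christoffel_def christoffel_low_def by (rule lower_half_raised[OF assms])

lemma lower_spray:
  assumes "z \<in> S"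
  shows "(\<Sum>\<alpha>\<in>UNIV. metric l \<eta> \<alpha> z * spray l \<alpha> z) =
    1 / 2 * (\<Sum>\<mu>\<in>UNIV. \<Sum>\<nu>\<in>UNIV. christoffel_low l \<eta> \<mu> \<nu> z * (snd z $ \<mu> * snd z $ \<nu>))"
proof -
  have "(\<Sum>\<alpha>\<in>UNIV. metric l \<eta> \<alpha> z * spray l \<alpha> z) =
      1 / 2 * (\<Sum>\<alpha>\<in>UNIV. \<Sum>\<mu>\<in>UNIV. \<Sum>\<nu>\<in>UNIV.
        metric l \<eta> \<alpha> z * christoffel l \<alpha> \<mu> \<nu> z * (snd z $ \<mu> * snd z $ \<nu>))"
    by (simp add: spray_def sum_distrib_left sum_divide_distrib mult.assoc)
  also have "\<dots> = 1 / 2 * (\<Sum>\<mu>\<in>UNIV. \<Sum>\<nu>\<in>UNIV. \<Sum>\<alpha>\<in>UNIV.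
        metric l \<eta> \<alpha> z * christoffel l \<alpha> \<mu> \<nu> z * (snd z $ \<mu> * snd z $ \<nu>))"
    by (subst sum.swap) (subst (2) sum.swap, rule refl)
  finally show ?thesis
    by (simp only: sum_distrib_right[symmetric] lower_christoffel[OF assms])
qed

lemma dy_christoffel_low:
  assumes "z \<in> S"
  shows "dy \<kappa> (christoffel_low l \<eta> \<mu> \<nu>) z =
    1 / 2 * (dx \<mu> (dy \<kappa> (metric l \<nu> \<eta>)) z + dx \<nu> (dy \<kappa> (metric l \<mu> \<eta>)) z
      - dx \<eta> (dy \<kappa> (metric l \<mu> \<nu>)) z)"
proof -
  have d: "dx \<mu> (metric l \<nu> \<eta>) differentiable (at z)" for \<mu> \<nu> \<eta>
    by (intro diff_smooth[OF _ assms] smooth_intros smooth_metric)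
  show ?thesis
    unfolding christoffel_low_def[abs_def]
    by (subst coordinate_derivative_scale; (intro derivative_intros d)?)
      (simp add: coordinate_derivative_rules d coordinate_derivatives_commute[OF open_S smooth_metric assms]
        differentiable_add)
qed

text \<open>Of the three terms of the Christoffel symbol only the one whose \<open>x\<close>-derivative is in the direction
  \<open>y\<close> survives; in the other two \<open>y\<close> is contracted with a slot of the fibre derivative of the
  metric.\<close>

lemma dy_christoffel_low_contraction:
  assumes "z \<in> S"
  shows "(\<Sum>\<nu>\<in>UNIV. dy \<kappa> (christoffel_low l \<eta> \<mu> \<nu>) z * snd z $ \<nu>) =
    1 / 2 * (\<Sum>\<nu>\<in>UNIV. dx \<nu> (dy \<kappa> (metric l \<mu> \<eta>)) z * snd z $ \<nu>)"
proof -
  have "(\<Sum>\<nu>\<in>UNIV. dy \<kappa> (christoffel_low l \<eta> \<mu> \<nu>) z * snd z $ \<nu>) =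
    1 / 2 * ((\<Sum>\<nu>\<in>UNIV. dx \<mu> (dy \<kappa> (metric l \<nu> \<eta>)) z * snd z $ \<nu>)
      + (\<Sum>\<nu>\<in>UNIV. dx \<nu> (dy \<kappa> (metric l \<mu> \<eta>)) z * snd z $ \<nu>)
      - (\<Sum>\<nu>\<in>UNIV. dx \<eta> (dy \<kappa> (metric l \<mu> \<nu>)) z * snd z $ \<nu>))"
    unfolding dy_christoffel_low[OF assms]
    by (simp add: sum.distrib sum_subtractf sum_divide_distrib algebra_simps add_divide_distrib diff_divide_distrib)
  then show ?thesis
    by (simp add: dx_cartan_fibre_contraction[OF assms])
qed

lemma dy_christoffel_low_double_contraction:
  assumes "z \<in> S"
  shows "(\<Sum>\<mu>\<in>UNIV. \<Sum>\<nu>\<in>UNIV. dy \<kappa> (christoffel_low l \<eta> \<mu> \<nu>) z * (snd z $ \<mu> * snd z $ \<nu>)) = 0"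
proof -
  have "(\<Sum>\<mu>\<in>UNIV. \<Sum>\<nu>\<in>UNIV. dy \<kappa> (christoffel_low l \<eta> \<mu> \<nu>) z * (snd z $ \<mu> * snd z $ \<nu>)) =
    (\<Sum>\<mu>\<in>UNIV. (\<Sum>\<nu>\<in>UNIV. dy \<kappa> (christoffel_low l \<eta> \<mu> \<nu>) z * snd z $ \<nu>) * snd z $ \<mu>)"
    by (simp add: sum_distrib_left mult_ac)
  also have "\<dots> = 1 / 2 * (\<Sum>\<mu>\<in>UNIV. \<Sum>\<nu>\<in>UNIV.
      dx \<nu> (dy \<kappa> (metric l \<mu> \<eta>)) z * snd z $ \<mu> * snd z $ \<nu>)"
    unfolding dy_christoffel_low_contraction[OF assms]
    by (simp add: sum_distrib_left sum_divide_distrib mult_ac)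
  also have "\<dots> = 1 / 2 * (\<Sum>\<nu>\<in>UNIV. (\<Sum>\<mu>\<in>UNIV.
      dx \<nu> (dy \<kappa> (metric l \<mu> \<eta>)) z * snd z $ \<mu>) * snd z $ \<nu>)"
    by (subst sum.swap) (simp add: sum_distrib_right)
  finally show ?thesis
    by (simp add: dx_cartan_fibre_contraction[OF assms])
qed

text \<open>The fibre derivative of the lowered spray. By the double contraction above only the
  derivatives of the two factors \<open>y\<close> contribute on the right, and they contribute equally.\<close>

lemma lower_barthel:
  assumes "z \<in> S"
  shows "(\<Sum>\<alpha>\<in>UNIV. metric l \<eta> \<alpha> z * barthel l \<alpha> \<mu> z) =
    (\<Sum>\<nu>\<in>UNIV. christoffel_low l \<eta> \<mu> \<nu> z * snd z $ \<nu>)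
    - (\<Sum>\<alpha>\<in>UNIV. dy \<mu> (metric l \<eta> \<alpha>) z * spray l \<alpha> z)"
proof -
  note d = diff_smooth[OF smooth_metric assms] diff_smooth[OF smooth_spray assms]
    diff_smooth[OF smooth_christoffel_low assms] differentiable_fibre_coordinate
  have "dy \<mu> (\<lambda>z. \<Sum>\<alpha>\<in>UNIV. metric l \<eta> \<alpha> z * spray l \<alpha> z) z =
    dy \<mu> (\<lambda>z. 1 / 2 * (\<Sum>\<mu>\<in>UNIV. \<Sum>\<nu>\<in>UNIV. christoffel_low l \<eta> \<mu> \<nu> z * (snd z $ \<mu> * snd z $ \<nu>))) z"
    by (rule coordinate_derivative_cong[OF open_S assms])
      (erule lower_spray, intro diff_smooth[OF _ assms] smooth_intros smooth_metric smooth_spray)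
  also have "\<dots> = 1 / 2 * (\<Sum>\<kappa>\<in>UNIV. \<Sum>\<nu>\<in>UNIV.
      christoffel_low l \<eta> \<kappa> \<nu> z * (snd z $ \<kappa> * (if \<nu> = \<mu> then 1 else 0)
        + (if \<kappa> = \<mu> then 1 else 0) * snd z $ \<nu>)
      + dy \<mu> (christoffel_low l \<eta> \<kappa> \<nu>) z * (snd z $ \<kappa> * snd z $ \<nu>))"
    by (subst coordinate_derivative_scale(2))
      (simp_all add: coordinate_derivative_sum coordinate_derivative_rules
        derivative_fibre_coordinate d differentiable_sum differentiable_mult)
  also have "\<dots> = 1 / 2 * ((\<Sum>\<kappa>\<in>UNIV. christoffel_low l \<eta> \<kappa> \<mu> z * snd z $ \<kappa>)
      + (\<Sum>\<nu>\<in>UNIV. christoffel_low l \<eta> \<mu> \<nu> z * snd z $ \<nu>))"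
    using dy_christoffel_low_double_contraction[OF assms, of \<mu> \<eta>]
    by (simp add: sum.distrib distrib_left if_distrib[where f="\<lambda>x. _ * x"]
        if_distrib[where f="\<lambda>x. x * _"] cong: if_cong) (subst sum.swap, simp)
  also have "\<dots> = (\<Sum>\<nu>\<in>UNIV. christoffel_low l \<eta> \<mu> \<nu> z * snd z $ \<nu>)"
    by (simp add: christoffel_low_commute[of l \<eta> _ \<mu>])
  finally show ?thesis
    by (simp add: coordinate_derivative_sum coordinate_derivative_rules d differentiable_mult
        sum.distrib barthel_def algebra_simps)
qed


text \<open>The second fibre derivative of the metric is symmetric in all four indices, as fibre derivatives
  commute and the first one is totally symmetric.\<close>

lemma cartan_derivative_commute:
  assumes "z \<in> S"
  shows "dy \<nu> (dy \<mu> (metric l \<eta> \<alpha>)) z = dy \<alpha> (dy \<nu> (metric l \<mu> \<eta>)) z"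
proof -
  have "dy \<nu> (dy \<mu> (metric l \<eta> \<alpha>)) z = dy \<nu> (dy \<alpha> (metric l \<mu> \<eta>)) z"
  proof (rule coordinate_derivative_cong[OF open_S assms])
    fix w assume "w \<in> S"
    then show "dy \<mu> (metric l \<eta> \<alpha>) w = dy \<alpha> (metric l \<mu> \<eta>) w"
      using cartan_swap[of w \<mu> \<alpha> \<eta>] by (simp add: metric_commute)
  qed (intro diff_smooth[OF _ assms] smooth_intros smooth_metric)
  then show ?thesis
    by (simp add: coordinate_derivatives_commute[OF open_S smooth_metric assms])
qed

text \<open>Differentiating the formula for the lowered Barthel connection along the fibres, with the product
  rule on both sides; the term in the derivative of the metric on the left moves to the right.\<close>

lemma lower_dy_barthel:
  assumes "z \<in> S"
  shows "(\<Sum>\<alpha>\<in>UNIV. metric l \<eta> \<alpha> z * dy \<nu> (barthel l \<alpha> \<mu>) z) =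
    christoffel_low l \<eta> \<mu> \<nu> z
    + 1 / 2 * (\<Sum>\<beta>\<in>UNIV. dx \<beta> (dy \<nu> (metric l \<mu> \<eta>)) z * snd z $ \<beta>)
    - (\<Sum>\<alpha>\<in>UNIV. dy \<alpha> (dy \<nu> (metric l \<mu> \<eta>)) z * spray l \<alpha> z)
    - (\<Sum>\<alpha>\<in>UNIV. dy \<mu> (metric l \<eta> \<alpha>) z * barthel l \<alpha> \<nu> z)
    - (\<Sum>\<alpha>\<in>UNIV. dy \<nu> (metric l \<eta> \<alpha>) z * barthel l \<alpha> \<mu> z)"
proof -
  note d = diff_smooth[OF smooth_metric assms] diff_smooth[OF smooth_spray assms]
    diff_smooth[OF smooth_barthel assms] diff_smooth[OF smooth_christoffel_low assms]
    diff_smooth[OF smooth_on_coordinate_derivative(2)[OF smooth_metric] assms]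
    differentiable_fibre_coordinate
  have "dy \<nu> (\<lambda>z. \<Sum>\<alpha>\<in>UNIV. metric l \<eta> \<alpha> z * barthel l \<alpha> \<mu> z) z =
    dy \<nu> (\<lambda>z. (\<Sum>\<nu>\<in>UNIV. christoffel_low l \<eta> \<mu> \<nu> z * snd z $ \<nu>)
      - (\<Sum>\<alpha>\<in>UNIV. dy \<mu> (metric l \<eta> \<alpha>) z * spray l \<alpha> z)) z"
    by (rule coordinate_derivative_cong[OF open_S assms])
      (erule lower_barthel, intro diff_smooth[OF _ assms] smooth_intros smooth_metric smooth_barthel)
  also have "\<dots> = christoffel_low l \<eta> \<mu> \<nu> z
      + (\<Sum>\<beta>\<in>UNIV. dy \<nu> (christoffel_low l \<eta> \<mu> \<beta>) z * snd z $ \<beta>)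
      - (\<Sum>\<alpha>\<in>UNIV. dy \<nu> (dy \<mu> (metric l \<eta> \<alpha>)) z * spray l \<alpha> z)
      - (\<Sum>\<alpha>\<in>UNIV. dy \<mu> (metric l \<eta> \<alpha>) z * barthel l \<alpha> \<nu> z)"
    by (simp add: coordinate_derivative_sum coordinate_derivative_rules
        derivative_fibre_coordinate d differentiable_sum differentiable_mult sum.distrib
        if_distrib[where f="\<lambda>x. _ * x"] barthel_def cong: if_cong)
  also have "dy \<nu> (\<lambda>z. \<Sum>\<alpha>\<in>UNIV. metric l \<eta> \<alpha> z * barthel l \<alpha> \<mu> z) z =
      (\<Sum>\<alpha>\<in>UNIV. metric l \<eta> \<alpha> z * dy \<nu> (barthel l \<alpha> \<mu>) z)
      + (\<Sum>\<alpha>\<in>UNIV. dy \<nu> (metric l \<eta> \<alpha>) z * barthel l \<alpha> \<mu> z)"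
    by (simp add: coordinate_derivative_sum coordinate_derivative_rules d differentiable_mult sum.distrib)
  finally show ?thesis
    by (simp add: dy_christoffel_low_contraction[OF assms]
        cartan_derivative_commute[OF assms, of \<nu> \<mu> \<eta>])
qed

text \<open>Euler's relation for the spray, which is homogeneous of degree two. It follows from the
  formula for the lowered Barthel connection: contracted with \<open>y\<close>, its first sum is twice the
  lowered spray and its second sum vanishes.\<close>

lemma barthel_fibre_contraction:
  assumes "z \<in> S"
  shows "(\<Sum>\<beta>\<in>UNIV. barthel l \<alpha> \<beta> z * snd z $ \<beta>) = 2 * spray l \<alpha> z"
proof (rule lower_injective[OF assms, where Y="\<lambda>\<alpha>. 2 * spray l \<alpha> z"])
  fix \<eta>
  have "(\<Sum>\<beta>\<in>UNIV. (\<Sum>\<alpha>\<in>UNIV. dy \<beta> (metric l \<eta> \<alpha>) z * spray l \<alpha> z) * snd z $ \<beta>) =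
      (\<Sum>\<alpha>\<in>UNIV. \<Sum>\<beta>\<in>UNIV. dy \<beta> (metric l \<eta> \<alpha>) z * spray l \<alpha> z * snd z $ \<beta>)"
    unfolding sum_distrib_right by (rule sum.swap)
  also have "\<dots> = (\<Sum>\<alpha>\<in>UNIV. spray l \<alpha> z * (\<Sum>\<beta>\<in>UNIV. snd z $ \<beta> * dy \<beta> (metric l \<eta> \<alpha>) z))"
    by (simp add: sum_distrib_left mult_ac)
  also have "\<dots> = 0" by (simp add: euler_metric[OF assms])
  finally have C: "(\<Sum>\<beta>\<in>UNIV. (\<Sum>\<alpha>\<in>UNIV. dy \<beta> (metric l \<eta> \<alpha>) z * spray l \<alpha> z) * snd z $ \<beta>) = 0" .
  have "(\<Sum>\<alpha>\<in>UNIV. metric l \<eta> \<alpha> z * (\<Sum>\<beta>\<in>UNIV. barthel l \<alpha> \<beta> z * snd z $ \<beta>)) =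
      (\<Sum>\<beta>\<in>UNIV. (\<Sum>\<nu>\<in>UNIV. christoffel_low l \<eta> \<beta> \<nu> z * snd z $ \<nu>) * snd z $ \<beta>)"
    by (simp add: contraction_assoc lower_barthel[OF assms] left_diff_distrib sum_subtractf C)
  also have "\<dots> = 2 * (\<Sum>\<alpha>\<in>UNIV. metric l \<eta> \<alpha> z * spray l \<alpha> z)"
    using lower_spray[OF assms, of \<eta>] by (simp add: sum_distrib_left mult_ac)
  finally show "(\<Sum>\<alpha>\<in>UNIV. metric l \<eta> \<alpha> z * (\<Sum>\<beta>\<in>UNIV. barthel l \<alpha> \<beta> z * snd z $ \<beta>)) =
      (\<Sum>\<alpha>\<in>UNIV. metric l \<eta> \<alpha> z * (2 * spray l \<alpha> z))"
    by (simp add: sum_distrib_left mult_ac)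
qed

subsection \<open>Differentiation along the spray\<close>

lemma delta_y_eq:
  assumes "z \<in> S"
  shows "delta_y l f z = (\<Sum>\<beta>\<in>UNIV. dx \<beta> f z * snd z $ \<beta>) - 2 * (\<Sum>\<alpha>\<in>UNIV. dy \<alpha> f z * spray l \<alpha> z)"
proof -
  have "(\<Sum>\<beta>\<in>UNIV. snd z $ \<beta> * (\<Sum>\<alpha>\<in>UNIV. barthel l \<alpha> \<beta> z * dy \<alpha> f z)) =
      (\<Sum>\<alpha>\<in>UNIV. 2 * spray l \<alpha> z * dy \<alpha> f z)"
    using barthel_fibre_contraction[OF assms]
    by (simp add: contraction_assoc) (simp add: mult.commute)
  then show ?thesis
    by (simp add: delta_y_def delta_def right_diff_distrib sum_subtractf sum_distrib_left mult_ac)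
qed

lemma delta_diff:
  assumes "f differentiable (at z)" "g differentiable (at z)"
  shows "delta l \<mu> (\<lambda>z. f z - g z) z = delta l \<mu> f z - delta l \<mu> g z"
  by (simp add: delta_def coordinate_derivative_rules assms sum_subtractf right_diff_distrib)

lemma delta_y_mult:
  assumes "z \<in> S" "f differentiable (at z)" "g differentiable (at z)"
  shows "delta_y l (\<lambda>z. f z * g z) z = f z * delta_y l g z + delta_y l f z * g z"
  by (simp add: delta_y_eq[OF assms(1)] coordinate_derivative_rules assms(2,3)
      sum.distrib sum_distrib_left algebra_simps)

lemma delta_y_scale:
  assumes "z \<in> S" "f differentiable (at z)"
  shows "delta_y l (\<lambda>z. a * f z) z = a * delta_y l f z"
  by (simp add: delta_y_eq[OF assms(1)] coordinate_derivative_scale assms(2)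
      sum_distrib_left algebra_simps)

lemma delta_y_sum:
  assumes "z \<in> S" "\<And>i. i \<in> I \<Longrightarrow> f i differentiable (at z)"
  shows "delta_y l (\<lambda>z. \<Sum>i\<in>I. f i z) z = (\<Sum>i\<in>I. delta_y l (f i) z)"
  by (simp add: delta_y_eq[OF assms(1)] coordinate_derivative_sum assms(2)
      sum_subtractf sum_distrib_left sum_distrib_right sum.swap[of _ I])

lemma delta_y_cong:
  assumes "z \<in> S" "\<And>w. w \<in> S \<Longrightarrow> f w = g w" "f differentiable (at z)"
  shows "delta_y l f z = delta_y l g z"
  using coordinate_derivative_cong[OF open_S assms] by (simp add: delta_y_eq[OF assms(1)])

lemma delta_metric_fibre_contraction:
  assumes "z \<in> S"
  shows "(\<Sum>\<beta>\<in>UNIV. delta l \<mu> (metric l \<eta> \<beta>) z * snd z $ \<beta>) =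
    (\<Sum>\<beta>\<in>UNIV. dx \<mu> (metric l \<eta> \<beta>) z * snd z $ \<beta>)"
proof -
  have "(\<Sum>\<beta>\<in>UNIV. (\<Sum>\<alpha>\<in>UNIV. barthel l \<alpha> \<mu> z * dy \<alpha> (metric l \<eta> \<beta>) z) * snd z $ \<beta>) = 0"
    unfolding contraction_assoc[symmetric] by (simp add: cartan_fibre_contraction[OF assms])
  then show ?thesis
    by (simp add: delta_def left_diff_distrib sum_subtractf)
qed

text \<open>This says that the metric is parallel along the spray for the connection \<open>N\<close>. In the sum of the two
  lowered Barthel coefficients the parts of the Christoffel symbols antisymmetric in the free
  indices cancel.\<close>

lemma delta_y_metric:
  assumes "z \<in> S"
  shows "delta_y l (metric l \<eta> \<alpha>) z =
    (\<Sum>\<sigma>\<in>UNIV. metric l \<eta> \<sigma> z * barthel l \<sigma> \<alpha> z) + (\<Sum>\<sigma>\<in>UNIV. metric l \<alpha> \<sigma> z * barthel l \<sigma> \<eta> z)"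
proof -
  have 1: "christoffel_low l \<eta> \<alpha> \<nu> z + christoffel_low l \<alpha> \<eta> \<nu> z = dx \<nu> (metric l \<eta> \<alpha>) z" for \<nu>
    by (simp add: christoffel_low_def metric_commute field_simps)
  have 2: "dy \<alpha> (metric l \<eta> \<sigma>) z = dy \<sigma> (metric l \<eta> \<alpha>) z"
    "dy \<eta> (metric l \<alpha> \<sigma>) z = dy \<sigma> (metric l \<eta> \<alpha>) z" for \<sigma>
    using cartan_swap[OF assms, of \<alpha> \<sigma> \<eta>] cartan_swap[OF assms, of \<eta> \<sigma> \<alpha>]
    by (simp_all add: metric_commute)
  show ?thesis
    unfolding lower_barthel[OF assms] delta_y_eq[OF assms] 1[symmetric] 2
    by (simp add: distrib_right sum.distrib)
qed

subsection \<open>Comparison of the Berwald and the Cartan connection\<close>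

lemma lower_Gamma_circ:
  assumes "z \<in> S"
  shows "(\<Sum>\<alpha>\<in>UNIV. metric l \<eta> \<alpha> z * Gamma_circ l \<alpha> \<mu> \<nu> z) =
    1 / 2 * (delta l \<mu> (metric l \<nu> \<eta>) z + delta l \<nu> (metric l \<mu> \<eta>) z - delta l \<eta> (metric l \<mu> \<nu>) z)"
  unfolding Gamma_circ_def by (rule lower_half_raised[OF assms])

text \<open>In the first and the third horizontal derivative of the metric the vertical part is annihilated by
  \<open>y\<close>, and in the second one it reproduces the spray term of the lowered Barthel connection.\<close>

lemma Gamma_circ_fibre_contraction:
  assumes "z \<in> S"
  shows "(\<Sum>\<beta>\<in>UNIV. Gamma_circ l \<alpha> \<mu> \<beta> z * snd z $ \<beta>) = barthel l \<alpha> \<mu> z"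
proof (rule lower_injective[OF assms, where X="\<lambda>\<alpha>. \<Sum>\<beta>\<in>UNIV. Gamma_circ l \<alpha> \<mu> \<beta> z * snd z $ \<beta>"])
  fix \<eta>
  have 1: "dy \<mu> (metric l \<eta> \<alpha>) z = dy \<alpha> (metric l \<mu> \<eta>) z" for \<alpha>
    using cartan_swap[OF assms, of \<mu> \<alpha> \<eta>] by (simp add: metric_commute)
  have "(\<Sum>\<alpha>\<in>UNIV. metric l \<eta> \<alpha> z * (\<Sum>\<beta>\<in>UNIV. Gamma_circ l \<alpha> \<mu> \<beta> z * snd z $ \<beta>)) =
      1 / 2 * ((\<Sum>\<beta>\<in>UNIV. delta l \<mu> (metric l \<eta> \<beta>) z * snd z $ \<beta>) + delta_y l (metric l \<mu> \<eta>) z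
        - (\<Sum>\<beta>\<in>UNIV. delta l \<eta> (metric l \<mu> \<beta>) z * snd z $ \<beta>))"
    unfolding contraction_assoc lower_Gamma_circ[OF assms] delta_y_def
    by (simp add: metric_commute[of l _ \<eta>] sum.distrib sum_subtractf sum_divide_distrib
        add_divide_distrib diff_divide_distrib algebra_simps)
  also have "\<dots> = (\<Sum>\<nu>\<in>UNIV. christoffel_low l \<eta> \<mu> \<nu> z * snd z $ \<nu>)
    - (\<Sum>\<alpha>\<in>UNIV. dy \<mu> (metric l \<eta> \<alpha>) z * spray l \<alpha> z)"
    unfolding delta_metric_fibre_contraction[OF assms] delta_y_eq[OF assms] 1 christoffel_low_def
    by (simp add: metric_commute[of l _ \<eta>] sum.distrib sum_subtractf sum_divide_distrib
        add_divide_distrib diff_divide_distrib algebra_simps)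
      (simp flip: sum_divide_distrib)
  finally show "(\<Sum>\<alpha>\<in>UNIV. metric l \<eta> \<alpha> z * (\<Sum>\<beta>\<in>UNIV. Gamma_circ l \<alpha> \<mu> \<beta> z * snd z $ \<beta>)) =
      (\<Sum>\<alpha>\<in>UNIV. metric l \<eta> \<alpha> z * barthel l \<alpha> \<mu> z)"
    by (simp add: lower_barthel[OF assms])
qed

text \<open>By total symmetry two of the three terms in the definition of \<open>C\<^sup>\<circ>\<close> cancel.\<close>

lemma lower_C_circ:
  assumes "z \<in> S"
  shows "(\<Sum>\<alpha>\<in>UNIV. metric l \<eta> \<alpha> z * C_circ l \<alpha> \<mu> \<nu> z) = 1 / 2 * dy \<nu> (metric l \<mu> \<eta>) z"
proof -
  have "dy \<mu> (metric l \<nu> \<eta>) z = dy \<eta> (metric l \<mu> \<nu>) z"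
    using cartan_swap[OF assms, of \<mu> \<eta> \<nu>] by (simp add: metric_commute)
  then show ?thesis
    unfolding C_circ_def by (subst lower_half_raised[OF assms]) simp
qed


text \<open>The Christoffel symbols drop out of the difference. What remains is the Landsberg tensor: half
  of the derivative along the spray of the fibre derivative of the metric, corrected by \<open>N\<close> in each
  of its three slots.\<close>

lemma lower_dy_barthel_minus_Gamma_circ:
  assumes "z \<in> S"
  shows "(\<Sum>\<alpha>\<in>UNIV. metric l \<eta> \<alpha> z * (dy \<nu> (barthel l \<alpha> \<mu>) z - Gamma_circ l \<alpha> \<mu> \<nu> z)) =
    1 / 2 * (delta_y l (dy \<nu> (metric l \<mu> \<eta>)) z
      - (\<Sum>\<sigma>\<in>UNIV. dy \<nu> (metric l \<mu> \<sigma>) z * barthel l \<sigma> \<eta> z)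
      - (\<Sum>\<sigma>\<in>UNIV. dy \<nu> (metric l \<sigma> \<eta>) z * barthel l \<sigma> \<mu> z)
      - (\<Sum>\<sigma>\<in>UNIV. dy \<sigma> (metric l \<mu> \<eta>) z * barthel l \<sigma> \<nu> z))"
proof -
  have c: "dy \<mu> (metric l \<eta> \<sigma>) z = dy \<sigma> (metric l \<mu> \<eta>) z"
    "dy \<nu> (metric l \<eta> \<sigma>) z = dy \<nu> (metric l \<sigma> \<eta>) z"
    "dy \<sigma> (metric l \<nu> \<eta>) z = dy \<nu> (metric l \<sigma> \<eta>) z"
    "dy \<sigma> (metric l \<mu> \<nu>) z = dy \<nu> (metric l \<mu> \<sigma>) z" for \<sigma>
    using cartan_swap[OF assms, of \<mu> \<sigma> \<eta>] cartan_swap[OF assms, of \<sigma> \<nu> \<eta>]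
      cartan_swap[OF assms, of \<sigma> \<nu> \<mu>] by (simp_all add: metric_commute)
  have sums: "(\<Sum>\<sigma>\<in>UNIV. dy \<mu> (metric l \<eta> \<sigma>) z * barthel l \<sigma> \<nu> z) =
      (\<Sum>\<sigma>\<in>UNIV. dy \<sigma> (metric l \<mu> \<eta>) z * barthel l \<sigma> \<nu> z)"
    "(\<Sum>\<sigma>\<in>UNIV. dy \<nu> (metric l \<eta> \<sigma>) z * barthel l \<sigma> \<mu> z) =
      (\<Sum>\<sigma>\<in>UNIV. dy \<nu> (metric l \<sigma> \<eta>) z * barthel l \<sigma> \<mu> z)"
    "(\<Sum>\<sigma>\<in>UNIV. barthel l \<sigma> \<mu> z * dy \<sigma> (metric l \<nu> \<eta>) z) =
      (\<Sum>\<sigma>\<in>UNIV. dy \<nu> (metric l \<sigma> \<eta>) z * barthel l \<sigma> \<mu> z)"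
    "(\<Sum>\<sigma>\<in>UNIV. barthel l \<sigma> \<nu> z * dy \<sigma> (metric l \<mu> \<eta>) z) =
      (\<Sum>\<sigma>\<in>UNIV. dy \<sigma> (metric l \<mu> \<eta>) z * barthel l \<sigma> \<nu> z)"
    "(\<Sum>\<sigma>\<in>UNIV. barthel l \<sigma> \<eta> z * dy \<sigma> (metric l \<mu> \<nu>) z) =
      (\<Sum>\<sigma>\<in>UNIV. dy \<nu> (metric l \<mu> \<sigma>) z * barthel l \<sigma> \<eta> z)"
    by (simp_all only: c mult.commute[of "barthel l _ _ z"])
  have "(\<Sum>\<alpha>\<in>UNIV. metric l \<eta> \<alpha> z * (dy \<nu> (barthel l \<alpha> \<mu>) z - Gamma_circ l \<alpha> \<mu> \<nu> z)) =
    (\<Sum>\<alpha>\<in>UNIV. metric l \<eta> \<alpha> z * dy \<nu> (barthel l \<alpha> \<mu>) z)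
    - (\<Sum>\<alpha>\<in>UNIV. metric l \<eta> \<alpha> z * Gamma_circ l \<alpha> \<mu> \<nu> z)"
    by (simp add: right_diff_distrib sum_subtractf)
  then show ?thesis
    unfolding lower_dy_barthel[OF assms] lower_Gamma_circ[OF assms] delta_y_eq[OF assms]
      delta_def christoffel_low_def sums
    by (simp add: algebra_simps)
qed

text \<open>This is the relation between the Berwald and the Cartan connection. After the contraction with
  \<open>y\<close> every \<open>\<Gamma>\<^sup>\<circ>\<close> becomes \<open>N\<close>, and the lowered identity is the previous lemma: lowering
  commutes with the covariant derivative along the spray because the metric is parallel.\<close>

lemma dy_barthel_eq:
  assumes "z \<in> S"
  shows "dy \<nu> (barthel l \<alpha> \<mu>) z = Gamma_circ l \<alpha> \<mu> \<nu> z +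
    (\<Sum>\<beta>\<in>UNIV. snd z $ \<beta> * (delta l \<beta> (C_circ l \<alpha> \<mu> \<nu>) z
      + (\<Sum>\<rho>\<in>UNIV. C_circ l \<rho> \<mu> \<nu> z * Gamma_circ l \<alpha> \<rho> \<beta> z)
      - (\<Sum>\<rho>\<in>UNIV. C_circ l \<alpha> \<rho> \<nu> z * Gamma_circ l \<rho> \<mu> \<beta> z)
      - (\<Sum>\<rho>\<in>UNIV. C_circ l \<alpha> \<mu> \<rho> z * Gamma_circ l \<rho> \<nu> \<beta> z)))"
    (is "_ = _ + ?R")
proof -
  \<comment> \<open>The contracted covariant derivative after every \<open>\<Gamma>\<^sup>\<circ>\<close> has become \<open>N\<close>.\<close>
  define R where "R \<alpha> = delta_y l (C_circ l \<alpha> \<mu> \<nu>) z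
      + (\<Sum>\<rho>\<in>UNIV. barthel l \<alpha> \<rho> z * C_circ l \<rho> \<mu> \<nu> z)
      - (\<Sum>\<rho>\<in>UNIV. C_circ l \<alpha> \<rho> \<nu> z * barthel l \<rho> \<mu> z)
      - (\<Sum>\<rho>\<in>UNIV. C_circ l \<alpha> \<mu> \<rho> z * barthel l \<rho> \<nu> z)" for \<alpha>
  have contract: "(\<Sum>\<beta>\<in>UNIV. snd z $ \<beta> * (\<Sum>\<rho>\<in>UNIV. X \<rho> * Gamma_circ l (i \<rho>) (j \<rho>) \<beta> z)) =
      (\<Sum>\<rho>\<in>UNIV. X \<rho> * barthel l (i \<rho>) (j \<rho>) z)" for X and i j :: "'n \<Rightarrow> 'n"
  proof -
    have "(\<Sum>\<beta>\<in>UNIV. snd z $ \<beta> * (\<Sum>\<rho>\<in>UNIV. X \<rho> * Gamma_circ l (i \<rho>) (j \<rho>) \<beta> z)) =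
        (\<Sum>\<beta>\<in>UNIV. \<Sum>\<rho>\<in>UNIV. X \<rho> * (Gamma_circ l (i \<rho>) (j \<rho>) \<beta> z * snd z $ \<beta>))"
      by (simp add: sum_distrib_left mult_ac)
    also have "\<dots> = (\<Sum>\<rho>\<in>UNIV. \<Sum>\<beta>\<in>UNIV. X \<rho> * (Gamma_circ l (i \<rho>) (j \<rho>) \<beta> z * snd z $ \<beta>))"
      by (rule sum.swap)
    finally show ?thesis
      by (simp only: sum_distrib_left[symmetric] Gamma_circ_fibre_contraction[OF assms])
  qed
  have "?R = R \<alpha>"
    unfolding R_def delta_y_def distrib_left right_diff_distrib sum.distrib sum_subtractf contract
    by (simp only: mult.commute[of "barthel l \<alpha> _ z"])
  moreover have "dy \<nu> (barthel l \<alpha> \<mu>) z - Gamma_circ l \<alpha> \<mu> \<nu> z = R \<alpha>"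
  proof (rule lower_injective[OF assms, where Y=R])
    fix \<eta>
    note d = diff_smooth[OF smooth_metric assms] diff_smooth[OF smooth_C_circ assms]
      diff_smooth[OF smooth_on_coordinate_derivative(2)[OF smooth_metric] assms]
    have "delta_y l (\<lambda>z. \<Sum>\<alpha>\<in>UNIV. metric l \<eta> \<alpha> z * C_circ l \<alpha> \<mu> \<nu> z) z =
        delta_y l (\<lambda>z. 1 / 2 * dy \<nu> (metric l \<mu> \<eta>) z) z"
      by (rule delta_y_cong[OF assms])
        (erule lower_C_circ, intro diff_smooth[OF _ assms] smooth_intros smooth_metric smooth_C_circ)
    then have D: "(\<Sum>\<alpha>\<in>UNIV. metric l \<eta> \<alpha> z * delta_y l (C_circ l \<alpha> \<mu> \<nu>) z) =
        1 / 2 * delta_y l (dy \<nu> (metric l \<mu> \<eta>)) z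
        - (\<Sum>\<alpha>\<in>UNIV. delta_y l (metric l \<eta> \<alpha>) z * C_circ l \<alpha> \<mu> \<nu> z)"
      by (subst (asm) delta_y_scale[OF assms d(3)])
        (simp add: delta_y_sum delta_y_mult assms d differentiable_mult sum.distrib)
    \<comment> \<open>When the index of \<open>R\<close> is lowered, the first sum cancels against the \<open>N\<close>-term of the
      upper index, and the second one becomes the \<open>N\<close>-term of the lowered index.\<close>
    have E: "(\<Sum>\<alpha>\<in>UNIV. delta_y l (metric l \<eta> \<alpha>) z * C_circ l \<alpha> \<mu> \<nu> z) =
        (\<Sum>\<alpha>\<in>UNIV. (\<Sum>\<sigma>\<in>UNIV. metric l \<eta> \<sigma> z * barthel l \<sigma> \<alpha> z) * C_circ l \<alpha> \<mu> \<nu> z)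
        + (\<Sum>\<sigma>\<in>UNIV. 1 / 2 * dy \<nu> (metric l \<mu> \<sigma>) z * barthel l \<sigma> \<eta> z)"
    proof -
      have "(\<Sum>\<alpha>\<in>UNIV. (\<Sum>\<sigma>\<in>UNIV. metric l \<alpha> \<sigma> z * barthel l \<sigma> \<eta> z) * C_circ l \<alpha> \<mu> \<nu> z) =
          (\<Sum>\<alpha>\<in>UNIV. C_circ l \<alpha> \<mu> \<nu> z * (\<Sum>\<sigma>\<in>UNIV. metric l \<sigma> \<alpha> z * barthel l \<sigma> \<eta> z))"
        by (simp add: mult.commute metric_commute)
      also have "\<dots> = (\<Sum>\<sigma>\<in>UNIV. (\<Sum>\<alpha>\<in>UNIV. metric l \<sigma> \<alpha> z * C_circ l \<alpha> \<mu> \<nu> z) * barthel l \<sigma> \<eta> z)"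
        unfolding contraction_assoc by (simp add: mult.commute)
      finally show ?thesis
        by (simp add: delta_y_metric[OF assms] distrib_right sum.distrib lower_C_circ[OF assms])
    qed
    have "(\<Sum>\<alpha>\<in>UNIV. metric l \<eta> \<alpha> z * R \<alpha>) =
        1 / 2 * delta_y l (dy \<nu> (metric l \<mu> \<eta>)) z
        - (\<Sum>\<sigma>\<in>UNIV. 1 / 2 * dy \<nu> (metric l \<mu> \<sigma>) z * barthel l \<sigma> \<eta> z)
        - (\<Sum>\<sigma>\<in>UNIV. 1 / 2 * dy \<nu> (metric l \<sigma> \<eta>) z * barthel l \<sigma> \<mu> z)
        - (\<Sum>\<sigma>\<in>UNIV. 1 / 2 * dy \<sigma> (metric l \<mu> \<eta>) z * barthel l \<sigma> \<nu> z)"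
      unfolding R_def distrib_left right_diff_distrib sum.distrib sum_subtractf D E
        contraction_assoc lower_C_circ[OF assms] by simp
    then show "(\<Sum>\<alpha>\<in>UNIV. metric l \<eta> \<alpha> z * (dy \<nu> (barthel l \<alpha> \<mu>) z - Gamma_circ l \<alpha> \<mu> \<nu> z)) =
        (\<Sum>\<alpha>\<in>UNIV. metric l \<eta> \<alpha> z * R \<alpha>)"
      unfolding lower_dy_barthel_minus_Gamma_circ[OF assms]
      by (simp add: sum_divide_distrib diff_divide_distrib)
  qed
  ultimately show ?thesis by simp
qed

text \<open>Linearity of the covariant derivative turns the first difference into the covariant derivative
  of \<open>C\<^sup>\<circ>\<close> with respect to \<open>\<Gamma>\<close>; the terms in \<open>A\<close> then subtract \<open>\<Gamma> - \<Gamma>\<^sup>\<circ>\<close> in each slot.\<close>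

lemma hcov_contortion:
  assumes "z \<in> S"
  shows "hcov l (C_can l) \<alpha> \<mu> \<nu> \<beta> z - hcov l (B_cont l) \<alpha> \<mu> \<nu> \<beta> z
      - (\<Sum>\<eta>\<in>UNIV. A_cont l \<alpha> \<eta> \<beta> z * (C_can l \<eta> \<mu> \<nu> z - B_cont l \<eta> \<mu> \<nu> z))
      + (\<Sum>\<eta>\<in>UNIV. A_cont l \<eta> \<mu> \<beta> z * (C_can l \<alpha> \<eta> \<nu> z - B_cont l \<alpha> \<eta> \<nu> z))
      + (\<Sum>\<eta>\<in>UNIV. A_cont l \<eta> \<nu> \<beta> z * (C_can l \<alpha> \<mu> \<eta> z - B_cont l \<alpha> \<mu> \<eta> z)) =
    delta l \<beta> (C_circ l \<alpha> \<mu> \<nu>) z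
      + (\<Sum>\<rho>\<in>UNIV. C_circ l \<rho> \<mu> \<nu> z * Gamma_circ l \<alpha> \<rho> \<beta> z)
      - (\<Sum>\<rho>\<in>UNIV. C_circ l \<alpha> \<rho> \<nu> z * Gamma_circ l \<rho> \<mu> \<beta> z)
      - (\<Sum>\<rho>\<in>UNIV. C_circ l \<alpha> \<mu> \<rho> z * Gamma_circ l \<rho> \<nu> \<beta> z)"
proof -
  have "delta l \<beta> (B_cont l \<alpha> \<mu> \<nu>) z = delta l \<beta> (C_can l \<alpha> \<mu> \<nu>) z - delta l \<beta> (C_circ l \<alpha> \<mu> \<nu>) z"
    unfolding B_cont_def[abs_def]
    by (intro delta_diff diff_smooth[OF smooth_C_can assms] diff_smooth[OF smooth_C_circ assms])
  then show ?thesis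
    by (simp add: hcov_def A_cont_def B_cont_def sum.distrib sum_subtractf algebra_simps)
qed

end

section \<open>From the manifold to one chart\<close>

context
  fixes M :: "'a topology" and \<A> :: "('a, 'n::finite) chart set"
  assumes manifold: "smooth_manifold M \<A>"
begin

lemma chart_domain_open: "c \<in> \<A> \<Longrightarrow> openin M (fst c)"
  using manifold by (auto simp: smooth_manifold_def is_chart_def)

lemma chart_homeomorphic:
  "c \<in> \<A> \<Longrightarrow> homeomorphic_map (subtopology M (fst c)) (top_of_set (snd c ` fst c)) (snd c)"
  using manifold by (auto simp: smooth_manifold_def is_chart_def)

lemma chart_image_open:
  assumes "c \<in> \<A>" "openin M U" "U \<subseteq> fst c"
  shows "open (snd c ` U)"
proof -
  have "openin (subtopology M (fst c)) U"
    using assms(2,3) by (auto simp: openin_subtopology)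
  then have "openin (top_of_set (snd c ` fst c)) (snd c ` U)"
    using homeomorphic_imp_open_map[OF chart_homeomorphic[OF assms(1)]] by (auto simp: open_map_def)
  moreover have "open (snd c ` fst c)"
    using manifold assms(1) by (auto simp: smooth_manifold_def is_chart_def)
  ultimately show ?thesis by (auto intro: openin_open_trans)
qed

lemma chart_inverse:
  assumes "c \<in> \<A>" "p \<in> fst c"
  shows "chart_inv c (snd c p) = p"
proof -
  have "topspace (subtopology M (fst c)) = fst c"
    using openin_subset[OF chart_domain_open[OF assms(1)]] by auto
  then have "inj_on (snd c) (fst c)"
    using homeomorphic_imp_injective_map[OF chart_homeomorphic[OF assms(1)]] by simp
  then show ?thesis using assms(2) by (simp add: chart_inv_def)
qed

lemma transition_chart:
  "c \<in> \<A> \<Longrightarrow> p \<in> fst c \<Longrightarrow> transition c d (snd c p) = snd d p"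
  by (simp add: transition_def chart_inverse)

lemma transition_differentiable:
  assumes "c \<in> \<A>" "d \<in> \<A>" "p \<in> fst c" "p \<in> fst d"
  shows "transition c d differentiable (at (snd c p))"
proof (rule smooth_on_differentiable)
  show "smooth_on (transition c d) (snd c ` (fst c \<inter> fst d))"
    using manifold assms(1,2) by (simp add: smooth_manifold_def)
  show "snd c p \<in> snd c ` (fst c \<inter> fst d)"
    using assms(3,4) by blast
qed

lemma transition_derivative_self:
  assumes "c \<in> \<A>" "p \<in> fst c"
  shows "frechet_derivative (transition c c) (at (snd c p)) y = y"
proof -
  have "frechet_derivative (transition c c) (at (snd c p)) y = frechet_derivative (\<lambda>x. x) (at (snd c p)) y"
  proof (rule frechet_derivative_cong_open)
    show "open (snd c ` fst c)"
      by (intro chart_image_open chart_domain_open assms order_refl)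
  qed (use assms transition_chart[OF assms(1), of _ c] transition_differentiable[OF assms(1,1)] in auto)
  then show ?thesis by simp
qed

lemma transition_derivative_compose:
  assumes "c \<in> \<A>" "d \<in> \<A>" "e \<in> \<A>" "p \<in> fst c" "p \<in> fst d" "p \<in> fst e"
  shows "frechet_derivative (transition c e) (at (snd c p)) y =
    frechet_derivative (transition d e) (at (snd d p)) (frechet_derivative (transition c d) (at (snd c p)) y)"
proof -
  have "frechet_derivative (transition c e) (at (snd c p)) y =
      frechet_derivative (transition d e \<circ> transition c d) (at (snd c p)) y"
  proof (rule frechet_derivative_cong_open)
    show "open (snd c ` (fst c \<inter> fst d \<inter> fst e))"
      using assms by (intro chart_image_open openin_Int chart_domain_open) auto
    show "snd c p \<in> snd c ` (fst c \<inter> fst d \<inter> fst e)"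
      using assms by blast
    show "transition c e w = (transition d e \<circ> transition c d) w"
      if "w \<in> snd c ` (fst c \<inter> fst d \<inter> fst e)" for w
      using that assms(1-3) by (auto simp: transition_chart)
    show "transition c e differentiable (at (snd c p))"
      using assms by (intro transition_differentiable)
  qed
  also have "\<dots> = (frechet_derivative (transition d e) (at (transition c d (snd c p))) \<circ>
      frechet_derivative (transition c d) (at (snd c p))) y"
    using assms by (subst frechet_derivative_compose) (simp_all add: transition_chart transition_differentiable)
  finally show ?thesis using assms by (simp add: transition_chart)
qed

text \<open>The chain rule for three charts makes the components in the charts \<open>d\<close> and \<open>e\<close> compatible although
  both are defined from the components in \<open>c\<close>.\<close>

lemma tvec_of_tangent:
  assumes "c \<in> \<A>" "p \<in> fst c"
  shows "tvec_of \<A> c p y \<in> tangent_space \<A> p"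
  unfolding tangent_space_def mem_Collect_eq
proof (intro conjI ballI allI impI)
  fix d e assume "d \<in> \<A>" "e \<in> \<A>" "p \<in> fst d \<and> p \<in> fst e"
  then show "tvec_of \<A> c p y e = frechet_derivative (transition d e) (at (snd d p)) (tvec_of \<A> c p y d)"
    using transition_derivative_compose[OF assms(1) _ _ assms(2), of d e y]
    unfolding tvec_of_def by simp
next
  fix d assume "\<not> (d \<in> \<A> \<and> p \<in> fst d)"
  then show "tvec_of \<A> c p y d = 0"
    unfolding tvec_of_def by (rule if_not_P)
qed

lemma tvec_of_component:
  "c \<in> \<A> \<Longrightarrow> p \<in> fst c \<Longrightarrow> tvec_of \<A> c p y c = y"
  by (simp add: tvec_of_def transition_derivative_self)

lemma tvec_of_scale:
  assumes "c \<in> \<A>" "p \<in> fst c"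
  shows "tvec_of \<A> c p (t *\<^sub>R y) = (\<lambda>d. t *\<^sub>R tvec_of \<A> c p y d)"
  using linear_cmul[OF linear_frechet_derivative[OF transition_differentiable[OF assms(1) _ assms(2)]]]
  by (auto simp: tvec_of_def)

text \<open>A combination of tangent vectors that vanishes in one chart vanishes in all, because the
  components are related by linear maps. This transfers the independence of the frame, stated for
  tangent vectors, to the components in a chart.\<close>

lemma tangent_combination_eq_zero:
  assumes "c \<in> \<A>" "p \<in> fst c" "\<And>i. i \<in> I \<Longrightarrow> w i \<in> tangent_space \<A> p"
    and "(\<Sum>i\<in>I. a i *\<^sub>R w i c) = 0"
  shows "(\<Sum>i\<in>I. a i *\<^sub>R w i d) = 0"
proof (cases "d \<in> \<A> \<and> p \<in> fst d")
  case True
  let ?D = "frechet_derivative (transition c d) (at (snd c p))"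
  have "linear ?D"
    using True assms by (intro linear_frechet_derivative transition_differentiable) auto
  have "w i d = ?D (w i c)" if "i \<in> I" for i
    using assms(1,2) assms(3)[OF that] True unfolding tangent_space_def by blast
  then have "(\<Sum>i\<in>I. a i *\<^sub>R w i d) = ?D (\<Sum>i\<in>I. a i *\<^sub>R w i c)"
    by (simp add: linear_sum[OF \<open>linear ?D\<close>] linear_cmul[OF \<open>linear ?D\<close>])
  then show ?thesis
    using assms(4) linear_0[OF \<open>linear ?D\<close>] by simp
next
  case False
  then have "w i d = 0" if "i \<in> I" for i
    using assms(3)[OF that] unfolding tangent_space_def by blast
  then show ?thesis by simp
qed

end

text \<open>A point \<open>(x, y)\<close> of the coordinate domain is the coordinate image of a nonzero tangent vector, to which
  the conditions on an FP-space apply; scaling \<open>y\<close> scales the tangent vector.\<close>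

lemma FP_space_coordinates:
  fixes M :: "'a topology" and \<A> :: "('a, 'n::finite) chart set"
  assumes FP: "FP_space M \<A> lam F" and c: "c \<in> \<A>"
  shows "fp_coordinates (slit_domain c) (frame_in \<A> c lam)"
proof -
  have manifold: "smooth_manifold M \<A>"
    and sections: "smooth_section M \<A> (lam i)"
    and independent: "\<And>p v a. p \<in> topspace M \<Longrightarrow> v \<in> tangent_space \<A> p - {zero_tvec} \<Longrightarrow>
       (\<lambda>c. \<Sum>i\<in>UNIV. a i *\<^sub>R lam i p v c) = zero_tvec \<Longrightarrow> \<forall>i. a i = 0"
    and symmetric: "\<And>z. z \<in> slit_domain c \<Longrightarrow>
       totally_symmetric3 (\<lambda>\<alpha> \<mu> \<nu>. dy \<alpha> (metric (frame_in \<A> c lam) \<mu> \<nu>) z)"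
    and homogeneous: "\<And>p v t. p \<in> topspace M \<Longrightarrow> v \<in> tangent_space \<A> p - {zero_tvec} \<Longrightarrow>
       t > 0 \<Longrightarrow> lam i p (\<lambda>c. t *\<^sub>R v c) = lam i p v" for i
    using FP c unfolding FP_space_def by blast+
  note chart = chart_domain_open[OF manifold c] chart_image_open[OF manifold c]
  have base: "chart_inv c (fst z) \<in> fst c" "chart_inv c (fst z) \<in> topspace M" "snd z \<noteq> 0"
    if z: "z \<in> slit_domain c" for z
  proof -
    show "chart_inv c (fst z) \<in> fst c" "snd z \<noteq> 0"
      using z chart_inverse[OF manifold c] by (auto simp: slit_domain_def)
    then show "chart_inv c (fst z) \<in> topspace M"
      using openin_subset[OF chart(1)] by blast
  qed
  have vector: "tvec_of \<A> c (chart_inv c (fst z)) (snd z) \<in>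
      tangent_space \<A> (chart_inv c (fst z)) - {zero_tvec}" if z: "z \<in> slit_domain c" for z
    using tvec_of_tangent[OF manifold c base(1)[OF z]] tvec_of_component[OF manifold c base(1)[OF z]]
      base(3)[OF z] by (auto simp: zero_tvec_def dest: fun_cong[where x=c])
  show ?thesis
  proof
    show "open (slit_domain c)"
      unfolding slit_domain_def by (intro open_Times chart order_refl) auto
    show "smooth_on (frame_in \<A> c lam i) (slit_domain c)" for i
      using sections[of i] c by (simp add: smooth_section_def frame_in_def)
    fix z assume z: "z \<in> slit_domain c"
    define p where "p = chart_inv c (fst z)"
    define v where "v = tvec_of \<A> c p (snd z)"
    note pv = base[OF z, folded p_def] vector[OF z, folded p_def, folded v_def]
    have frame: "frame_in \<A> c lam i z = lam i p v c" for i
      by (simp add: frame_in_def components_def p_def v_def)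
    show "totally_symmetric3 (\<lambda>\<alpha> \<mu> \<nu>. dy \<alpha> (metric (frame_in \<A> c lam) \<mu> \<nu>) z)"
      using z by (rule symmetric)
    show "frame_in \<A> c lam i (fst z, t *\<^sub>R snd z) = frame_in \<A> c lam i z" if "t > 0" for t i
      unfolding frame using homogeneous[OF pv(2,4) that, of i]
      by (simp add: frame_in_def components_def p_def[symmetric] tvec_of_scale[OF manifold c pv(1)]
          v_def)
    have tangent: "lam i p v \<in> tangent_space \<A> p" for i
      using sections[of i] pv(2,4) by (simp add: smooth_section_def)
    have "\<forall>i. a i = 0"
      if "(\<Sum>i\<in>UNIV. a i *s row i (\<chi> i \<alpha>. frame_up (frame_in \<A> c lam) i \<alpha> z)) = 0" for a
    proof (rule independent[OF pv(2,4)])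
      have "(\<Sum>i\<in>UNIV. a i *\<^sub>R lam i p v c) = 0"
        using that by (simp add: row_def frame_up_def frame scalar_mult_eq_scaleR)
      from tangent_combination_eq_zero[OF manifold c pv(1) tangent this]
      show "(\<lambda>c. \<Sum>i\<in>UNIV. a i *\<^sub>R lam i p v c) = zero_tvec"
        by (simp add: zero_tvec_def)
    qed
    then show "invertible (\<chi> i \<alpha>. frame_up (frame_in \<A> c lam) i \<alpha> z)"
      unfolding invertible_right_inverse matrix_right_invertible_independent_rows by blast
  qed
qed

section \<open>Torsion tensors of the canonical connection\<close>

theorem proposition3p7:
  fixes M :: "'a topology"
    and \<A> :: "('a, 'n::finite) chart set"
    and lam :: "'n \<Rightarrow> ('a, 'n) psection"
    and F :: "'a \<Rightarrow> ('a, 'n) tvec \<Rightarrow> real"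
    and c :: "('a, 'n) chart"
    and l :: "'n frame"
    and D :: "'n finsler_connection"
    and z :: "(real ^ 'n) \<times> (real ^ 'n)"
    and \<alpha> \<mu> \<nu> :: 'n
  assumes "FP_space M \<A> lam F"
    and "c \<in> \<A>"
    and "z \<in> slit_domain c"
    and "l = frame_in \<A> c lam"
    and "D = canonical_connection l"
  shows "hh_torsion D \<alpha> \<mu> \<nu> z = Gamma_can l \<alpha> \<mu> \<nu> z - Gamma_can l \<alpha> \<nu> \<mu> z
    \<and> h_hv_torsion D \<alpha> \<mu> \<nu> z = (\<Sum>i\<in>UNIV. frame_up l i \<alpha> z * dy \<nu> (frame_low l i \<mu>) z)
    \<and> v_hv_torsion D \<alpha> \<mu> \<nu> z =
        (\<Sum>\<beta>\<in>UNIV. snd z $ \<beta> *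
          (hcov l (C_can l) \<alpha> \<mu> \<nu> \<beta> z - hcov l (B_cont l) \<alpha> \<mu> \<nu> \<beta> z
           - (\<Sum>\<eta>\<in>UNIV. A_cont l \<alpha> \<eta> \<beta> z * (C_can l \<eta> \<mu> \<nu> z - B_cont l \<eta> \<mu> \<nu> z))
           + (\<Sum>\<eta>\<in>UNIV. A_cont l \<eta> \<mu> \<beta> z * (C_can l \<alpha> \<eta> \<nu> z - B_cont l \<alpha> \<eta> \<nu> z))
           + (\<Sum>\<eta>\<in>UNIV. A_cont l \<eta> \<nu> \<beta> z * (C_can l \<alpha> \<mu> \<eta> z - B_cont l \<alpha> \<mu> \<eta> z))))
        - A_cont l \<alpha> \<mu> \<nu> z
    \<and> vv_torsion D \<alpha> \<mu> \<nu> z = C_can l \<alpha> \<mu> \<nu> z - C_can l \<alpha> \<nu> \<mu> z"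
proof -
  interpret fp_coordinates "slit_domain c" l
    using FP_space_coordinates[OF assms(1,2)] assms(4) by simp
  have "v_hv_torsion D \<alpha> \<mu> \<nu> z = dy \<nu> (barthel l \<alpha> \<mu>) z - Gamma_circ l \<alpha> \<mu> \<nu> z - A_cont l \<alpha> \<mu> \<nu> z"
    by (simp add: assms(5) v_hv_torsion_def canonical_connection_def A_cont_def)
  then show ?thesis
    unfolding hcov_contortion[OF assms(3)] dy_barthel_eq[OF assms(3)]
    by (simp add: assms(5) hh_torsion_def h_hv_torsion_def vv_torsion_def canonical_connection_def C_can_def)
qed

end
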